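(* Let $(N,g,f)$ be a gradient shrinking Kähler Ricci soliton with Kähler form $\omega$, and let $F:L\to N$ be a compact Lagrangian self-similar solution (i.e. $L$ is a compact manifold, $F$ is a Lagrangian immersion, and $H(F)=\lambda\nabla f^{\bot}$ for some constant $\lambda\in\mathbb R$) whose mean curvature form $\omega_H$ is exact. Then $F:L\to N$ is a minimal Lagrangian immersion, i.e. $H(F)=0$.
   Context: A gradient shrinking Kähler Ricci soliton $(N,g,f)$ is a Kähler manifold $N$ (complex structure $J$, Kähler metric $g$, Kähler form $\omega$), complete, with a smooth function $f$ satisfying $\mathrm{Ric}(g)+\mathrm{Hess} f-\frac12 g=0$. $H(F)$ is the mean curvature vector field of $F$ with respect to $g$; $\nabla f$ along $F$ means $(\nabla f)\circ F$, and $\bot$ is the projection to the normal bundle of $F$. The mean curvature form $\omega_H$ is the 1-form on $L$ defined by $\omega_H(X):=\omega(H(F),F_*X)$; it is exact if $\omega_H=d\theta$ for a smooth function $\theta$ on $L$. *)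

theory Defs
  imports "HOL-Analysis.Analysis"
begin

text \<open>
  Conventions.  A manifold is a whole Hausdorff, second countable type together with a smooth atlas.
  A tensor field is given classically, by its components in the charts of the atlas: a component is
  a function of the coordinate point and of vectors of the model space, and components in
  overlapping charts are related by the derivative of the change of coordinates.  The local
  notions of Riemannian geometry are therefore defined for a metric \<open>G x v w\<close> on an open subset
  of a Euclidean space (\<open>x\<close> the point, \<open>v\<close>, \<open>w\<close> tangent vectors).
\<close>

section \<open>Calculus in Euclidean space\<close>

abbreviation D :: "('a::real_normed_vector \<Rightarrow> 'b::real_normed_vector) \<Rightarrow> 'a \<Rightarrow> 'a \<Rightarrow> 'b" where
  "D h x v \<equiv> frechet_derivative h (at x) v"

text \<open>Being of class \<open>C\<^sup>k\<close> on a set; only used for open sets of a finite-dimensional space.\<close>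

fun Ck_on :: "nat \<Rightarrow> 'a::euclidean_space set \<Rightarrow> ('a \<Rightarrow> 'b::real_normed_vector) \<Rightarrow> bool" where
  "Ck_on 0 S h \<longleftrightarrow> continuous_on S h"
| "Ck_on (Suc k) S h \<longleftrightarrow>
     (\<forall>x\<in>S. h differentiable (at x)) \<and> (\<forall>v. Ck_on k S (\<lambda>x. D h x v))"

definition smooth_on :: "'a::euclidean_space set \<Rightarrow> ('a \<Rightarrow> 'b::real_normed_vector) \<Rightarrow> bool" where
  "smooth_on S h \<longleftrightarrow> (\<forall>k. Ck_on k S h)"

section \<open>Local Riemannian geometry\<close>

type_synonym 'e metric = "'e \<Rightarrow> 'e \<Rightarrow> 'e \<Rightarrow> real"

text \<open>The Christoffel symbols \<open>\<Gamma>(v,w) = \<Sum>\<^sub>i\<^sub>j v\<^sup>i w\<^sup>j \<Gamma>\<^sub>i\<^sub>j\<^sup>k \<partial>\<^sub>k\<close> of the Levi-Civita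
  connection: the Koszul formula for constant vector fields.\<close>

definition christoffel :: "'e::euclidean_space metric \<Rightarrow> 'e \<Rightarrow> 'e \<Rightarrow> 'e \<Rightarrow> 'e" where
  "christoffel G x v w = (THE z. \<forall>u. 2 * G x z u =
     D (\<lambda>y. G y w u) x v + D (\<lambda>y. G y v u) x w - D (\<lambda>y. G y v w) x u)"

text \<open>\<open>R(u,v)w = \<nabla>\<^sub>u\<nabla>\<^sub>v w - \<nabla>\<^sub>v\<nabla>\<^sub>u w\<close> for constant vector fields \<open>u\<close>, \<open>v\<close>, \<open>w\<close>, which commute.\<close>

definition riemann :: "'e::euclidean_space metric \<Rightarrow> 'e \<Rightarrow> 'e \<Rightarrow> 'e \<Rightarrow> 'e \<Rightarrow> 'e" where
  "riemann G x u v w =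
     D (\<lambda>y. christoffel G y v w) x u - D (\<lambda>y. christoffel G y u w) x v
     + christoffel G x u (christoffel G x v w) - christoffel G x v (christoffel G x u w)"

text \<open>The trace of \<open>u \<mapsto> R(u,v)w\<close>; a trace does not depend on the basis, so the standard basis
  of the model space may be used although it is not \<open>G\<close>-orthonormal.\<close>

definition ricci :: "'e::euclidean_space metric \<Rightarrow> 'e \<Rightarrow> 'e \<Rightarrow> 'e \<Rightarrow> real" where
  "ricci G x v w = (\<Sum>b\<in>Basis. riemann G x b v w \<bullet> b)"

definition gradient :: "'e::euclidean_space metric \<Rightarrow> ('e \<Rightarrow> real) \<Rightarrow> 'e \<Rightarrow> 'e" where
  "gradient G h x = (THE z. \<forall>u. G x z u = D h x u)"

definition hessian :: "'e::euclidean_space metric \<Rightarrow> ('e \<Rightarrow> real) \<Rightarrow> 'e \<Rightarrow> 'e \<Rightarrow> 'e \<Rightarrow> real" where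
  "hessian G h x v w = D (\<lambda>y. D h y w) x v - D h x (christoffel G x v w)"

section \<open>Local geometry of an immersion\<close>

text \<open>The normal part \<open>z\<^sup>\<bottom>\<close> of a vector \<open>z\<close> at \<open>\<Phi> x\<close>.\<close>

definition normal_part ::
    "'e::euclidean_space metric \<Rightarrow> ('b::euclidean_space \<Rightarrow> 'e) \<Rightarrow> 'b \<Rightarrow> 'e \<Rightarrow> 'e" where
  "normal_part G \<Phi> x z =
     (THE y. (\<exists>t. z - y = D \<Phi> x t) \<and> (\<forall>s. G (\<Phi> x) y (D \<Phi> x s) = 0))"

text \<open>\<open>(\<nabla>\<^sub>u (\<Phi>\<^sub>* v))\<^sup>\<bottom>\<close> for constant vector fields \<open>u\<close>, \<open>v\<close>, with \<open>\<nabla>\<close> the Levi-Civita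
  connection of the ambient metric pulled back along \<open>\<Phi>\<close>.\<close>

definition second_fundamental_form ::
    "'e::euclidean_space metric \<Rightarrow> ('b::euclidean_space \<Rightarrow> 'e) \<Rightarrow> 'b \<Rightarrow> 'b \<Rightarrow> 'b \<Rightarrow> 'e" where
  "second_fundamental_form G \<Phi> x u v = normal_part G \<Phi> x
     (D (\<lambda>y. D \<Phi> y v) x u + christoffel G (\<Phi> x) (D \<Phi> x u) (D \<Phi> x v))"

definition induced_gram ::
    "'e::euclidean_space metric \<Rightarrow> (real^'n \<Rightarrow> 'e) \<Rightarrow> real^'n \<Rightarrow> real^'n^'n" where
  "induced_gram G \<Phi> x = (\<chi> i j. G (\<Phi> x) (D \<Phi> x (axis i 1)) (D \<Phi> x (axis j 1)))"

text \<open>The (unnormalised) trace of the second fundamental form with respect to the induced metric.\<close>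

definition mean_curvature ::
    "'e::euclidean_space metric \<Rightarrow> (real^'n \<Rightarrow> 'e) \<Rightarrow> real^'n \<Rightarrow> 'e" where
  "mean_curvature G \<Phi> x = (\<Sum>i\<in>UNIV. \<Sum>j\<in>UNIV.
     (matrix_inv (induced_gram G \<Phi> x) $ i $ j) *\<^sub>R
       second_fundamental_form G \<Phi> x (axis i 1) (axis j 1))"

section \<open>Local Hermitian geometry\<close>

text \<open>The complex structure in a holomorphic chart.\<close>

definition J :: "complex^'n \<Rightarrow> complex^'n" where
  "J v = \<i> *s v"

definition kahler_form :: "(complex^'n) metric \<Rightarrow> complex^'n \<Rightarrow> complex^'n \<Rightarrow> complex^'n \<Rightarrow> real"
  where "kahler_form G x v w = G x (J v) w"

text \<open>The exterior derivative of a 2-form, evaluated on constant vector fields.\<close>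

definition d_two_form :: "('e::euclidean_space \<Rightarrow> 'e \<Rightarrow> 'e \<Rightarrow> real) \<Rightarrow> 'e \<Rightarrow> 'e \<Rightarrow> 'e \<Rightarrow> 'e \<Rightarrow> real" where
  "d_two_form \<alpha> x u v w =
     D (\<lambda>y. \<alpha> y v w) x u + D (\<lambda>y. \<alpha> y w u) x v + D (\<lambda>y. \<alpha> y u v) x w"

definition mean_curvature_form ::
    "(complex^'n) metric \<Rightarrow> (real^'n \<Rightarrow> complex^'n) \<Rightarrow> real^'n \<Rightarrow> real^'n \<Rightarrow> real" where
  "mean_curvature_form G \<Phi> x v = kahler_form G (\<Phi> x) (mean_curvature G \<Phi> x) (D \<Phi> x v)"

section \<open>Manifolds\<close>

datatype ('m, 'e) chart = Chart (cdom: "'m set") (cmap: "'m \<Rightarrow> 'e")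

abbreviation cran :: "('m, 'e) chart \<Rightarrow> 'e set" where
  "cran c \<equiv> cmap c ` cdom c"

abbreviation cinv :: "('m, 'e) chart \<Rightarrow> 'e \<Rightarrow> 'm" where
  "cinv c \<equiv> inv_into (cdom c) (cmap c)"

text \<open>The expression of a map between manifolds in charts, and its domain of definition; with the
  identity as map this is the change of coordinates.\<close>

abbreviation rep :: "('l, 'b) chart \<Rightarrow> ('m, 'e) chart \<Rightarrow> ('l \<Rightarrow> 'm) \<Rightarrow> 'b \<Rightarrow> 'e" where
  "rep a c F \<equiv> cmap c \<circ> F \<circ> cinv a"

abbreviation repdom :: "('l, 'b) chart \<Rightarrow> ('m, 'e) chart \<Rightarrow> ('l \<Rightarrow> 'm) \<Rightarrow> 'b set" where
  "repdom a c F \<equiv> cmap a ` (cdom a \<inter> F -` cdom c)"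

definition smooth_atlas ::
    "('m::{t2_space,second_countable_topology}, 'e::euclidean_space) chart set \<Rightarrow> bool" where
  "smooth_atlas A \<longleftrightarrow>
     (\<Union>c\<in>A. cdom c) = UNIV \<and>
     (\<forall>c\<in>A. open (cdom c) \<and> open (cran c) \<and>
        homeomorphism (cdom c) (cran c) (cmap c) (cinv c)) \<and>
     (\<forall>c\<in>A. \<forall>d\<in>A. smooth_on (repdom c d id) (rep c d id))"

definition smooth_map ::
    "('l::topological_space, 'b::euclidean_space) chart set \<Rightarrow>
     ('m::topological_space, 'e::euclidean_space) chart set \<Rightarrow> ('l \<Rightarrow> 'm) \<Rightarrow> bool" where
  "smooth_map B A F \<longleftrightarrow> continuous_on UNIV F \<and>
     (\<forall>a\<in>B. \<forall>c\<in>A. smooth_on (repdom a c F) (rep a c F))"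

definition smooth_function ::
    "('m, 'e::euclidean_space) chart set \<Rightarrow> ('m \<Rightarrow> real) \<Rightarrow> bool" where
  "smooth_function A h \<longleftrightarrow> (\<forall>c\<in>A. smooth_on (cran c) (h \<circ> cinv c))"

definition riemannian_metric ::
    "('m, 'e::euclidean_space) chart set \<Rightarrow> (('m, 'e) chart \<Rightarrow> 'e metric) \<Rightarrow> bool" where
  "riemannian_metric A g \<longleftrightarrow>
     (\<forall>c\<in>A.
        (\<forall>x\<in>cran c. bilinear (g c x) \<and> (\<forall>v w. g c x v w = g c x w v) \<and>
           (\<forall>v. v \<noteq> 0 \<longrightarrow> g c x v v > 0)) \<and>
        (\<forall>v w. smooth_on (cran c) (\<lambda>x. g c x v w))) \<and>
     (\<forall>c\<in>A. \<forall>d\<in>A. \<forall>x\<in>repdom c d id. \<forall>v w.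
        g c x v w = g d (rep c d id x) (D (rep c d id) x v) (D (rep c d id) x w))"

definition geodesic ::
    "('m::topological_space, 'e::euclidean_space) chart set \<Rightarrow> (('m, 'e) chart \<Rightarrow> 'e metric) \<Rightarrow>
     (real \<Rightarrow> 'm) \<Rightarrow> bool" where
  "geodesic A g \<gamma> \<longleftrightarrow> continuous_on UNIV \<gamma> \<and>
     (\<forall>c\<in>A. smooth_on (\<gamma> -` cdom c) (cmap c \<circ> \<gamma>) \<and>
        (\<forall>t\<in>\<gamma> -` cdom c.
           let \<gamma>' = (\<lambda>s. vector_derivative (cmap c \<circ> \<gamma>) (at s))
           in vector_derivative \<gamma>' (at t) + christoffel (g c) (cmap c (\<gamma> t)) (\<gamma>' t) (\<gamma>' t) = 0))"

text \<open>Geodesic completeness: every tangent vector is the initial velocity of a geodesic defined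
  for all times.\<close>

definition complete_metric ::
    "('m::topological_space, 'e::euclidean_space) chart set \<Rightarrow> (('m, 'e) chart \<Rightarrow> 'e metric) \<Rightarrow> bool"
  where
  "complete_metric A g \<longleftrightarrow> (\<forall>c\<in>A. \<forall>p\<in>cdom c. \<forall>v. \<exists>\<gamma>.
     geodesic A g \<gamma> \<and> \<gamma> 0 = p \<and> vector_derivative (cmap c \<circ> \<gamma>) (at 0) = v)"

section \<open>Kaehler manifolds and solitons\<close>

text \<open>A holomorphic atlas: the changes of coordinates have complex linear derivatives, so that
  \<open>J\<close> in the charts defines the complex structure of the manifold.\<close>

definition holomorphic_atlas ::
    "('m::{t2_space,second_countable_topology}, complex^'n) chart set \<Rightarrow> bool" where
  "holomorphic_atlas A \<longleftrightarrow> smooth_atlas A \<and>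
     (\<forall>c\<in>A. \<forall>d\<in>A. \<forall>x\<in>repdom c d id. \<forall>v.
        D (rep c d id) x (J v) = J (D (rep c d id) x v))"

definition kahler_manifold ::
    "('m::{t2_space,second_countable_topology}, complex^'n) chart set \<Rightarrow>
     (('m, complex^'n) chart \<Rightarrow> (complex^'n) metric) \<Rightarrow> bool" where
  "kahler_manifold A g \<longleftrightarrow> holomorphic_atlas A \<and> riemannian_metric A g \<and>
     (\<forall>c\<in>A. \<forall>x\<in>cran c. \<forall>v w. g c x (J v) (J w) = g c x v w) \<and>
     (\<forall>c\<in>A. \<forall>x\<in>cran c. \<forall>u v w. d_two_form (kahler_form (g c)) x u v w = 0)"

definition gradient_shrinking_kahler_ricci_soliton ::
    "('m::{t2_space,second_countable_topology}, complex^'n) chart set \<Rightarrow>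
     (('m, complex^'n) chart \<Rightarrow> (complex^'n) metric) \<Rightarrow> ('m \<Rightarrow> real) \<Rightarrow> bool" where
  "gradient_shrinking_kahler_ricci_soliton A g f \<longleftrightarrow>
     kahler_manifold A g \<and> complete_metric A g \<and> smooth_function A f \<and>
     (\<forall>c\<in>A. \<forall>x\<in>cran c. \<forall>v w.
        ricci (g c) x v w + hessian (g c) (f \<circ> cinv c) x v w - 1/2 * g c x v w = 0)"

section \<open>Lagrangian immersions\<close>

text \<open>Here and below \<open>B\<close> is an atlas of \<open>L\<close> and \<open>A\<close> a holomorphic atlas of \<open>N\<close>; the common index
  type of the model spaces forces the dimension of \<open>L\<close> to be half the real dimension of \<open>N\<close>.\<close>

definition lagrangian_immersion ::
    "('l::topological_space, real^'n) chart set \<Rightarrow> ('m::topological_space, complex^'n) chart set \<Rightarrow>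
     (('m, complex^'n) chart \<Rightarrow> (complex^'n) metric) \<Rightarrow> ('l \<Rightarrow> 'm) \<Rightarrow> bool" where
  "lagrangian_immersion B A g F \<longleftrightarrow> smooth_map B A F \<and>
     (\<forall>a\<in>B. \<forall>c\<in>A. \<forall>x\<in>repdom a c F.
        inj (D (rep a c F) x) \<and>
        (\<forall>u v. kahler_form (g c) (rep a c F x) (D (rep a c F) x u) (D (rep a c F) x v) = 0))"

definition self_similar_solution ::
    "('l, real^'n) chart set \<Rightarrow> ('m, complex^'n) chart set \<Rightarrow>
     (('m, complex^'n) chart \<Rightarrow> (complex^'n) metric) \<Rightarrow> ('m \<Rightarrow> real) \<Rightarrow> ('l \<Rightarrow> 'm) \<Rightarrow> bool" where
  "self_similar_solution B A g f F \<longleftrightarrow> (\<exists>\<kappa>::real. \<forall>a\<in>B. \<forall>c\<in>A. \<forall>x\<in>repdom a c F.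
     mean_curvature (g c) (rep a c F) x =
       \<kappa> *\<^sub>R normal_part (g c) (rep a c F) x (gradient (g c) (f \<circ> cinv c) (rep a c F x)))"

definition exact_mean_curvature_form ::
    "('l, real^'n) chart set \<Rightarrow> ('m, complex^'n) chart set \<Rightarrow>
     (('m, complex^'n) chart \<Rightarrow> (complex^'n) metric) \<Rightarrow> ('l \<Rightarrow> 'm) \<Rightarrow> bool" where
  "exact_mean_curvature_form B A g F \<longleftrightarrow> (\<exists>\<theta>. smooth_function B \<theta> \<and>
     (\<forall>a\<in>B. \<forall>c\<in>A. \<forall>x\<in>repdom a c F. \<forall>v.
        mean_curvature_form (g c) (rep a c F) x v = D (\<theta> \<circ> cinv a) x v))"

definition minimal_lagrangian_immersion ::
    "('l::topological_space, real^'n) chart set \<Rightarrow> ('m::topological_space, complex^'n) chart set \<Rightarrow>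
     (('m, complex^'n) chart \<Rightarrow> (complex^'n) metric) \<Rightarrow> ('l \<Rightarrow> 'm) \<Rightarrow> bool" where
  "minimal_lagrangian_immersion B A g F \<longleftrightarrow> lagrangian_immersion B A g F \<and>
     (\<forall>a\<in>B. \<forall>c\<in>A. \<forall>x\<in>repdom a c F. mean_curvature (g c) (rep a c F) x = 0)"

end

theory Submission
  imports Defs
begin

text \<open>
  In local coordinates let \<open>\<Phi>\<close> be the immersion, \<open>E\<^sub>i\<close> its coordinate tangent vectors, \<open>a\<close> the
  inverse of the induced metric and \<open>\<theta>\<close> a primitive of the mean curvature form.  Since \<open>J\<close> maps
  tangent vectors to normal ones, \<open>H = \<kappa> \<nabla>f\<^sup>\<bottom>\<close> gives \<open>d\<theta>(v) = -\<kappa> df(J \<Phi>\<^sub>*v)\<close>.  Differentiate this once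
  more and take the trace with respect to \<open>a\<close>.  The Hessian terms \<open>Hess f(E\<^sub>i, J E\<^sub>j)\<close> cancel, because
  on a Kaehler manifold \<open>Ric\<close>, hence on a soliton \<open>Hess f\<close>, is \<open>J\<close>-invariant.  What is left is
  \<open>-\<kappa> df(JH)\<close> plus tangential terms, and \<open>JH\<close> is itself the image of the gradient of \<open>\<theta>\<close>; so \<open>\<theta>\<close> satisfies
  an elliptic equation \<open>a\<^sup>i\<^sup>j \<partial>\<^sub>i\<partial>\<^sub>j\<theta> = d\<theta>(b)\<close> without zeroth order term.  By compactness and the strong
  maximum principle \<open>\<theta>\<close> is locally constant, so \<open>JH\<close>, and with it \<open>H\<close>, vanishes.
\<close>

section \<open>Differential calculus\<close>

text \<open>\<open>normal_part\<close> is never differentiated. Paired with the normal vector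
  \<open>J (D \<Phi> x v)\<close>, the projection drops out, and the identity for d\<theta> contains
  only first derivatives of f and \<Phi>. It is used twice: the coordinate Hessian of \<theta> omits
  the Christoffel symbols of the induced metric, which leaves a tangential error t, and the
  resulting term -\<kappa> df(J \<Phi>_* t) is again d\<theta>(t). With r the gradient of f along
  \<Phi> for the induced metric, the drift is b = t - \<kappa> r. As no zeroth order term appears,
  the maximum principle applies for either sign of \<kappa>. Christoffel symbols and the inverse of
  the induced metric are given implicitly, by \<open>THE\<close> and \<open>matrix_inv\<close>, so
  the regularity of the coefficients has to come from the linear systems that they solve; this is
  the purpose of \<open>solution_differentiable\<close>. L may be disconnected. Hence the maximum is
  taken over the points where \<theta> is not locally constant, and the conclusion d\<theta> = 0 is
  a local one.\<close>

lemma D_eq: "(f has_derivative f') (at x) \<Longrightarrow> D f x = f'"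
  by (metis frechet_derivative_at)

lemma D_has_derivative: "f differentiable (at x) \<Longrightarrow> (f has_derivative D f x) (at x)"
  by (simp add: frechet_derivative_works)

text \<open>\<open>frechet_derivative\<close> chooses from the set of all derivatives; functions
  agreeing near \<open>x\<close> have the same set, even when it is empty.\<close>

lemma D_cong:
  assumes "open S" "x \<in> S" "\<And>y. y \<in> S \<Longrightarrow> f y = g y"
  shows "D f x = D g x"
proof -
  have "(f has_derivative f') (at x) \<longleftrightarrow> (g has_derivative f') (at x)" for f'
    using assms by (metis has_derivative_transform_within_open)
  then show ?thesis by (simp add: frechet_derivative_def)
qed

lemma differentiable_cong_open:
  assumes "open S" "x \<in> S" "\<And>y. y \<in> S \<Longrightarrow> f y = g y" "g differentiable (at x)"
  shows "f differentiable (at x)"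
  using assms by (metis differentiable_def has_derivative_transform_within_open)

lemma linear_expand_Basis:
  fixes L :: "'e::euclidean_space \<Rightarrow> 'g::real_vector"
  assumes "linear L"
  shows "L v = (\<Sum>b\<in>Basis. (v \<bullet> b) *\<^sub>R L b)"
proof -
  interpret linear L by fact
  have "L v = L (\<Sum>b\<in>Basis. (v \<bullet> b) *\<^sub>R b)" by (simp add: euclidean_representation)
  also have "\<dots> = (\<Sum>b\<in>Basis. (v \<bullet> b) *\<^sub>R L b)" by (simp add: sum scale)
  finally show ?thesis .
qed

text \<open>Tensor components are known to be differentiable only for fixed vector arguments.
  Expanding in the finite basis turns \<open>L y (p y)\<close> into a sum of scalar coefficients
  times such components, which avoids derivatives in the operator norm.\<close>

lemma linear_family_has_derivative:
  fixes L :: "'x::real_normed_vector \<Rightarrow> 'e::euclidean_space \<Rightarrow> 'g::real_normed_vector"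
  assumes S: "open S" "x \<in> S" and lin: "\<And>y. y \<in> S \<Longrightarrow> linear (L y)"
    and diff: "\<And>v. (\<lambda>y. L y v) differentiable (at x)"
    and p: "(p has_derivative p') (at x)"
  shows "((\<lambda>y. L y (p y)) has_derivative (\<lambda>u. D (\<lambda>y. L y (p x)) x u + L x (p' u))) (at x)"
proof -
  have d: "((\<lambda>y. L y v) has_derivative D (\<lambda>y. L y v) x) (at x)" for v
    using diff by (rule D_has_derivative)
  have const: "D (\<lambda>y. L y (p x)) x = (\<lambda>u. \<Sum>b\<in>Basis. (p x \<bullet> b) *\<^sub>R D (\<lambda>y. L y b) x u)"
  proof -
    have "((\<lambda>y. \<Sum>b\<in>Basis. (p x \<bullet> b) *\<^sub>R L y b) has_derivative
        (\<lambda>u. \<Sum>b\<in>Basis. (p x \<bullet> b) *\<^sub>R D (\<lambda>y. L y b) x u)) (at x)"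
      by (intro has_derivative_sum has_derivative_scaleR_right d)
    then have "((\<lambda>y. L y (p x)) has_derivative
        (\<lambda>u. \<Sum>b\<in>Basis. (p x \<bullet> b) *\<^sub>R D (\<lambda>y. L y b) x u)) (at x)"
      by (rule has_derivative_transform_within_open[OF _ S])
        (use linear_expand_Basis[OF lin, symmetric] in auto)
    then show ?thesis by (rule D_eq)
  qed
  have "((\<lambda>y. \<Sum>b\<in>Basis. (p y \<bullet> b) *\<^sub>R L y b) has_derivative
      (\<lambda>u. \<Sum>b\<in>Basis. (p x \<bullet> b) *\<^sub>R D (\<lambda>y. L y b) x u + (p' u \<bullet> b) *\<^sub>R L x b)) (at x)"
    by (intro has_derivative_sum has_derivative_scaleR d has_derivative_inner_left p)
  then have "((\<lambda>y. L y (p y)) has_derivative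
      (\<lambda>u. \<Sum>b\<in>Basis. (p x \<bullet> b) *\<^sub>R D (\<lambda>y. L y b) x u + (p' u \<bullet> b) *\<^sub>R L x b)) (at x)"
    by (rule has_derivative_transform_within_open[OF _ S])
      (use linear_expand_Basis[OF lin, symmetric] in auto)
  then show ?thesis
    using linear_expand_Basis[OF lin[OF S(2)], symmetric] by (simp add: const sum.distrib)
qed

lemma bilinear_linear:
  assumes "bilinear B"
  shows "linear (B v)" "linear (\<lambda>v. B v w)"
  using assms by (auto simp: bilinear_def)

lemma bilinear_family_has_derivative:
  fixes B :: "'x::real_normed_vector \<Rightarrow> 'e::euclidean_space \<Rightarrow> 'f::euclidean_space \<Rightarrow>
    'g::real_normed_vector"
  assumes S: "open S" "x \<in> S" and bil: "\<And>y. y \<in> S \<Longrightarrow> bilinear (B y)"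
    and diff: "\<And>v w. (\<lambda>y. B y v w) differentiable (at x)"
    and p: "(p has_derivative p') (at x)" and q: "(q has_derivative q') (at x)"
  shows "((\<lambda>y. B y (p y) (q y)) has_derivative
    (\<lambda>u. D (\<lambda>y. B y (p x) (q x)) x u + B x (p' u) (q x) + B x (p x) (q' u))) (at x)"
proof -
  have 1: "((\<lambda>y. B y (p y) w) has_derivative (\<lambda>u. D (\<lambda>y. B y (p x) w) x u + B x (p' u) w)) (at x)"
    for w
    using S bilinear_linear(2)[OF bil] diff p by (rule linear_family_has_derivative)
  have "((\<lambda>y. B y (p y) (q y)) has_derivative
      (\<lambda>u. D (\<lambda>y. B y (p y) (q x)) x u + B x (p x) (q' u))) (at x)"
    by (rule linear_family_has_derivative[OF S bilinear_linear(1)[OF bil] _ q])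
      (use 1 in \<open>auto simp: differentiable_def\<close>)
  then show ?thesis by (simp add: D_eq[OF 1])
qed

text \<open>Since \<open>e x = 0\<close>, \<open>(p y - p x) *\<^sub>R e y\<close> is a null factor
  times something of order \<open>norm (y - x)\<close>, so continuity of \<open>p\<close> can
  replace differentiability. This is the bootstrap in \<open>solution_differentiable\<close>, where
  the coefficients depend on the unknown.\<close>

lemma has_derivative_scaleR_vanishing:
  fixes e :: "'x::real_normed_vector \<Rightarrow> 'g::real_normed_vector"
  assumes p: "isCont p x" and e: "(e has_derivative e') (at x)" and e0: "e x = 0"
  shows "((\<lambda>y. p y *\<^sub>R e y) has_derivative (\<lambda>u. p x *\<^sub>R e' u)) (at x)"
proof -
  have bl: "bounded_linear e'" using e by (rule has_derivative_bounded_linear)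
  let ?r = "\<lambda>y. norm (e y - e x - e' (y - x)) / norm (y - x)"
  have r: "(?r \<longlongrightarrow> 0) (at x)"
    using e by (simp add: has_derivative_iff_norm)
  have "((\<lambda>y. norm (p y - p x) * (?r y + onorm e')) \<longlongrightarrow> 0 * (0 + onorm e')) (at x)"
    using p by (intro tendsto_mult tendsto_add r tendsto_const)
      (auto intro: tendsto_norm_zero LIM_zero simp: isCont_def simp del: real_norm_def)
  then have lim: "((\<lambda>y. norm (p y - p x) * (?r y + onorm e')) \<longlongrightarrow> 0) (at x)" by simp
  have "((\<lambda>y. norm ((p y - p x) *\<^sub>R e y) / norm (y - x)) \<longlongrightarrow> 0) (at x)"
  proof (rule Lim_null_comparison[OF _ lim])
    have "norm (e y) / norm (y - x) \<le> ?r y + onorm e'" if "y \<noteq> x" for y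
    proof -
      have "norm (e y) \<le> norm (e y - e x - e' (y - x)) + onorm e' * norm (y - x)"
        using norm_triangle_sub[of "e y" "e' (y - x)"] onorm[OF bl, of "y - x"] e0
        by simp
      then show ?thesis using that by (simp add: field_simps)
    qed
    then show "\<forall>\<^sub>F y in at x. norm (norm ((p y - p x) *\<^sub>R e y) / norm (y - x))
        \<le> norm (p y - p x) * (?r y + onorm e')"
      unfolding eventually_at_filter
      by (intro always_eventually allI impI) (auto simp: mult_left_mono simp flip: times_divide_eq_right)
  qed
  then have "((\<lambda>y. (p y - p x) *\<^sub>R e y) has_derivative (\<lambda>u. 0)) (at x)"
    using e0 by (simp add: has_derivative_iff_norm)
  from has_derivative_add[OF this has_derivative_scaleR_right[OF e, of "p x"]]
  show ?thesis by (simp add: algebra_simps)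
qed

text \<open>Implicit differentiation of a positive definite linear system. The inner product turns
  it into \<open>T y (z y) = k y\<close>; coercivity of \<open>T\<close>, which persists near
  \<open>x\<close>, makes \<open>z\<close> continuous, and continuity is then upgraded to
  differentiability.\<close>

lemma solution_differentiable:
  fixes B :: "'x::real_normed_vector \<Rightarrow> 'e::euclidean_space \<Rightarrow> 'e \<Rightarrow> real"
  assumes S: "open S" "x \<in> S" and bil: "\<And>y. y \<in> S \<Longrightarrow> bilinear (B y)"
    and pos: "\<And>v. v \<noteq> 0 \<Longrightarrow> B x v v > 0"
    and diff: "\<And>v w. (\<lambda>y. B y v w) differentiable (at x)"
    and h: "\<And>w. (\<lambda>y. h y w) differentiable (at x)"
    and z: "\<And>y w. y \<in> S \<Longrightarrow> B y (z y) w = h y w"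
  shows "z differentiable (at x)"
proof -
  define T where "T y v = (\<Sum>b\<in>Basis. B y v b *\<^sub>R b)" for y v
  define k where "k y = (\<Sum>b\<in>Basis. h y b *\<^sub>R b)" for y
  define e where "e c y = T y c - T x c" for c y
  have Tin: "T y v \<bullet> w = B y v w" if "y \<in> S" for y v w
    using linear_expand_Basis[OF bilinear_linear(1)[OF bil[OF that]], of v w]
    by (simp add: T_def inner_sum_left inner_sum_right inner_commute mult.commute)
  have linT: "linear (T y)" if "y \<in> S" for y
    using bil[OF that] by (intro linearI) (simp_all add: T_def bilinear_ladd bilinear_lmul
      scaleR_left.add sum.distrib scaleR_right.sum scaleR_scaleR)
  have Tz: "T y (z y) = k y" if "y \<in> S" for y
    by (simp add: T_def k_def z that)
  have injT: "inj (T x)"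
  proof (rule linear_injective_0[OF linT[OF S(2)], THEN iffD2], intro allI impI)
    fix v assume "T x v = 0"
    then show "v = 0" using Tin[OF S(2), of v v] pos[of v] by force
  qed
  obtain \<beta> where \<beta>: "\<beta> > 0" "\<And>v. \<beta> * norm v \<le> norm (T x v)"
    using linear_inj_bounded_below_pos[OF linT[OF S(2)] injT] by metis
  obtain Ti where Ti: "linear Ti" "Ti \<circ> T x = id"
    using linear_injective_left_inverse[OF linT[OF S(2)] injT] by metis
  have dT: "(\<lambda>y. T y v) differentiable (at x)" for v
    unfolding T_def using diff by (intro differentiable_sum differentiable_scaleR) auto
  have dk: "k differentiable (at x)"
    unfolding k_def using h by (intro differentiable_sum differentiable_scaleR) auto
  have de: "e c differentiable (at x)" for c
    unfolding e_def using dT by (intro differentiable_diff) auto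
  have Texp: "T y v = T x v + (\<Sum>c\<in>Basis. (v \<bullet> c) *\<^sub>R e c y)" if "y \<in> S" for y v
    unfolding e_def
    by (subst (1 2) linear_expand_Basis[OF linT]) (use S that in \<open>simp_all add: scaleR_diff_right sum_subtractf\<close>)
  have ec: "(e c \<longlongrightarrow> 0) (at x)" for c
    using differentiable_imp_continuous_within[OF de] by (simp add: continuous_within e_def)
  have "((\<lambda>y. \<Sum>c\<in>Basis. norm (e c y)) \<longlongrightarrow> (\<Sum>c\<in>(Basis :: 'e set). 0)) (at x)"
    by (intro tendsto_sum tendsto_norm_zero ec)
  \<comment> \<open>A perturbation of size \<open>\<beta> / 2\<close> leaves half of the lower bound
    \<beta> of \<open>T x\<close>, whence the factor \<open>2 / \<beta>\<close> below.\<close>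
  then have "\<forall>\<^sub>F y in at x. (\<Sum>c\<in>Basis. norm (e c y)) < \<beta> / 2"
    using \<beta>(1) by (intro order_tendstoD(2)) auto
  moreover have inS: "\<forall>\<^sub>F y in at x. y \<in> S"
    using S by (simp add: eventually_at_topological) blast
  ultimately have coer: "\<forall>\<^sub>F y in at x. \<forall>v. norm v \<le> 2 / \<beta> * norm (T y v)"
  proof eventually_elim
    case (elim y)
    show ?case
    proof
      fix v
      have "norm (\<Sum>c\<in>Basis. (v \<bullet> c) *\<^sub>R e c y) \<le> (\<Sum>c\<in>Basis. norm v * norm (e c y))"
        by (intro sum_norm_le) (simp add: Basis_le_norm mult_right_mono)
      also have "\<dots> \<le> norm v * (\<beta> / 2)"
        unfolding sum_distrib_left[symmetric] using elim by (intro mult_left_mono) auto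
      finally have "\<beta> * norm v \<le> norm (T y v) + norm v * (\<beta> / 2)"
        using \<beta>(2)[of v] Texp[OF elim(2), of v] norm_triangle_ineq4[of "T y v" "\<Sum>c\<in>Basis. (v \<bullet> c) *\<^sub>R e c y"]
        by simp
      then show "norm v \<le> 2 / \<beta> * norm (T y v)" using \<beta>(1) by (simp add: field_simps)
    qed
  qed
  have "((\<lambda>y. 2 / \<beta> * norm (k y - T y (z x))) \<longlongrightarrow> 2 / \<beta> * norm (k x - T x (z x))) (at x)"
    using differentiable_imp_continuous_within[OF dk] differentiable_imp_continuous_within[OF dT]
    by (intro tendsto_intros) (simp_all add: continuous_within)
  then have lim: "((\<lambda>y. 2 / \<beta> * norm (k y - T y (z x))) \<longlongrightarrow> 0) (at x)"
    using Tz[OF S(2)] by simp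
  have "((\<lambda>y. z y - z x) \<longlongrightarrow> 0) (at x)"
  proof (rule Lim_null_comparison[OF _ lim])
    show "\<forall>\<^sub>F y in at x. norm (z y - z x) \<le> 2 / \<beta> * norm (k y - T y (z x))"
      using coer inS
    proof eventually_elim
      case (elim y)
      then show ?case using elim(1)[rule_format, of "z y - z x"]
        by (simp add: Tz linear_diff[OF linT])
    qed
  qed
  then have zc: "isCont z x" by (simp add: isCont_def LIM_zero_iff)
  \<comment> \<open>In the formula for \<open>z\<close> below, \<open>z\<close> itself occurs on the
    right only as coefficient of \<open>e c\<close>, and \<open>e c x = 0\<close>: its continuity is
    enough.\<close>
  have "(\<lambda>y. (z y \<bullet> c) *\<^sub>R e c y) differentiable (at x)" for c
    by (rule differentiableI, rule has_derivative_scaleR_vanishing[OF _ D_has_derivative[OF de]])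
      (auto intro!: continuous_intros zc simp: e_def)
  then have "(\<lambda>y. k y - (\<Sum>c\<in>Basis. (z y \<bullet> c) *\<^sub>R e c y)) differentiable (at x)"
    using dk by (intro differentiable_diff differentiable_sum) auto
  then have "(\<lambda>y. Ti (k y - (\<Sum>c\<in>Basis. (z y \<bullet> c) *\<^sub>R e c y))) differentiable (at x)"
    using linear_imp_differentiable[OF Ti(1)] differentiable_chain_at[of _ x Ti] by (simp add: o_def)
  moreover have "z y = Ti (k y - (\<Sum>c\<in>Basis. (z y \<bullet> c) *\<^sub>R e c y))" if "y \<in> S" for y
    using Texp[OF that, of "z y"] Tz[OF that] fun_cong[OF Ti(2), of "z y"] by simp
  ultimately show ?thesis
    by (rule differentiable_cong_open[OF S, rotated])
qed

section \<open>Second derivatives: symmetry, and sign at a maximum\<close>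

lemma DERIV_along_line:
  fixes h :: "'a::real_normed_vector \<Rightarrow> real"
  assumes "h differentiable (at (x + s *\<^sub>R v))"
  shows "((\<lambda>s. h (x + s *\<^sub>R v)) has_real_derivative D h (x + s *\<^sub>R v) v) (at s)"
proof -
  have "((\<lambda>s. x + s *\<^sub>R v) has_derivative (\<lambda>t. t *\<^sub>R v)) (at s)"
    by (auto intro!: derivative_eq_intros)
  from has_derivative_compose[OF this D_has_derivative[OF assms]]
  show ?thesis
    by (simp add: has_field_derivative_def linear_cmul[OF linear_frechet_derivative[OF assms]] mult.commute
      mult_commute_abs)
qed

text \<open>The mean value theorem along \<open>v\<close>, applied to the difference of
  \<open>h\<close> on two parallel segments a step \<open>t *\<^sub>R u\<close> apart, reduces the
  second difference to a first difference of \<open>D h y v\<close>, which differentiability at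
  \<open>x\<close> controls.\<close>

lemma second_difference_quotient:
  fixes h :: "'a::real_normed_vector \<Rightarrow> real"
  assumes S: "open S" "x \<in> S" and h: "\<And>y. y \<in> S \<Longrightarrow> h differentiable (at y)"
    and dh: "(\<lambda>y. D h y v) differentiable (at x)" and "\<epsilon> > 0"
  shows "\<exists>\<delta>>0. \<forall>t. 0 < t \<and> t < \<delta> \<longrightarrow>
    \<bar>h (x + t *\<^sub>R u + t *\<^sub>R v) - h (x + t *\<^sub>R u) - h (x + t *\<^sub>R v) + h x - t\<^sup>2 * D (\<lambda>y. D h y v) x u\<bar> \<le> \<epsilon> * t\<^sup>2"
proof -
  define k where "k y = D h y v" for y
  \<comment> \<open>\<open>t * K\<close> bounds the distance from \<open>x\<close> of every point
    that occurs; two first order errors of size \<open>\<eta> * (t * K)\<close> then add up to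
    \<open>\<epsilon> * t\<close>.\<close>
  define K where "K = norm u + norm v + 1"
  define \<eta> where "\<eta> = \<epsilon> / (2 * K)"
  have "K > 0" using norm_ge_zero[of u] norm_ge_zero[of v] unfolding K_def by linarith
  then have "\<eta> > 0" using \<open>\<epsilon> > 0\<close> by (simp add: \<eta>_def)
  have k: "(k has_derivative D k x) (at x)" using dh unfolding k_def by (rule D_has_derivative)
  have lin: "linear (D k x)" using k by (rule has_derivative_linear)
  obtain d1 where d1: "d1 > 0" "\<And>y. norm (y - x) < d1 \<Longrightarrow> norm (k y - k x - D k x (y - x)) \<le> \<eta> * norm (y - x)"
    using k \<open>\<eta> > 0\<close> unfolding has_derivative_at_alt by blast
  obtain d2 where d2: "d2 > 0" "ball x d2 \<subseteq> S"
    using S open_contains_ball by metis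
  define \<delta> where "\<delta> = min d1 d2 / K"
  have "\<delta> > 0" using d1 d2 \<open>K > 0\<close> by (simp add: \<delta>_def)
  moreover have "\<bar>h (x + t *\<^sub>R u + t *\<^sub>R v) - h (x + t *\<^sub>R u) - h (x + t *\<^sub>R v) + h x - t\<^sup>2 * D k x u\<bar> \<le> \<epsilon> * t\<^sup>2"
    if t: "0 < t" "t < \<delta>" for t
  proof -
    have tK: "t * K < d1" "t * K < d2" using t \<open>K > 0\<close> by (auto simp: \<delta>_def field_simps)
    have small: "norm (r *\<^sub>R u + s *\<^sub>R v) \<le> t * K" if "0 \<le> s" "s \<le> t" "0 \<le> r" "r \<le> t" for r s
    proof -
      have "norm (r *\<^sub>R u + s *\<^sub>R v) \<le> r * norm u + s * norm v"
        using norm_triangle_ineq[of "r *\<^sub>R u" "s *\<^sub>R v"] that by simp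
      also have "\<dots> \<le> t * norm u + t * norm v"
        using that by (intro add_mono mult_right_mono) auto
      also have "\<dots> \<le> t * K" using t by (simp add: K_def algebra_simps)
      finally show ?thesis .
    qed
    have dw: "dist x (x + w) = norm w" for w by (simp add: dist_norm)
    have inS: "x + r *\<^sub>R u + s *\<^sub>R v \<in> S" if "0 \<le> s" "s \<le> t" "0 \<le> r" "r \<le> t" for r s
      using small[OF that] tK by (intro subsetD[OF d2(2)]) (simp add: dw add.assoc)
    have inS0: "x + s *\<^sub>R v \<in> S" if "0 \<le> s" "s \<le> t" for s
      using inS[OF that, of 0] t by simp
    define \<phi> where "\<phi> s = h (x + t *\<^sub>R u + s *\<^sub>R v) - h (x + s *\<^sub>R v)" for s
    have "DERIV \<phi> s :> k (x + t *\<^sub>R u + s *\<^sub>R v) - k (x + s *\<^sub>R v)" if "0 \<le> s \<and> s \<le> t" for s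
      unfolding \<phi>_def k_def using that t
      by (intro DERIV_diff DERIV_along_line h inS inS0) auto
    from MVT2[OF t(1), of \<phi>, OF this] obtain s where s: "0 < s" "s < t"
      and eq: "\<phi> t - \<phi> 0 = t * (k (x + t *\<^sub>R u + s *\<^sub>R v) - k (x + s *\<^sub>R v))" by auto
    have est: "\<bar>k (x + r *\<^sub>R u + s *\<^sub>R v) - k x - (r * D k x u + s * D k x v)\<bar> \<le> \<eta> * (t * K)"
      if "0 \<le> r" "r \<le> t" for r
    proof -
      have sm: "norm (r *\<^sub>R u + s *\<^sub>R v) \<le> t * K" using small[of s r] that s by simp
      have "\<bar>k (x + r *\<^sub>R u + s *\<^sub>R v) - k x - D k x (r *\<^sub>R u + s *\<^sub>R v)\<bar> \<le> \<eta> * norm (r *\<^sub>R u + s *\<^sub>R v)"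
        using d1(2)[of "x + r *\<^sub>R u + s *\<^sub>R v"] sm tK by (simp add: add.assoc)
      also have "\<dots> \<le> \<eta> * (t * K)" using sm \<open>\<eta> > 0\<close> by (simp add: mult_left_mono)
      finally show ?thesis by (simp add: linear_add[OF lin] linear_cmul[OF lin])
    qed
    have "\<bar>k (x + t *\<^sub>R u + s *\<^sub>R v) - k (x + s *\<^sub>R v) - t * D k x u\<bar> \<le> 2 * (\<eta> * (t * K))"
      using est[of t] est[of 0] t by simp
    also have "\<dots> = \<epsilon> * t" using \<open>K > 0\<close> by (simp add: \<eta>_def)
    finally have le: "t * \<bar>k (x + t *\<^sub>R u + s *\<^sub>R v) - k (x + s *\<^sub>R v) - t * D k x u\<bar> \<le> t * (\<epsilon> * t)"
      using t by simp
    have "\<bar>t * (k (x + t *\<^sub>R u + s *\<^sub>R v) - k (x + s *\<^sub>R v)) - t\<^sup>2 * D k x u\<bar> \<le> \<epsilon> * t\<^sup>2"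
    proof -
      have "t * (k (x + t *\<^sub>R u + s *\<^sub>R v) - k (x + s *\<^sub>R v)) - t\<^sup>2 * D k x u =
          t * (k (x + t *\<^sub>R u + s *\<^sub>R v) - k (x + s *\<^sub>R v) - t * D k x u)"
        by (simp add: power2_eq_square algebra_simps)
      with le show ?thesis using t by (simp add: abs_mult power2_eq_square mult_ac)
    qed
    then show ?thesis unfolding eq[symmetric] by (simp add: \<phi>_def algebra_simps)
  qed
  ultimately show ?thesis unfolding k_def by blast
qed

text \<open>Both sides are the limit of the same second difference divided by
  \<open>t\<^sup>2\<close>, which is symmetric in \<open>u\<close> and \<open>v\<close>.\<close>

lemma second_derivative_symmetric:
  fixes h :: "'a::real_normed_vector \<Rightarrow> real"
  assumes S: "open S" "x \<in> S" and h: "\<And>y. y \<in> S \<Longrightarrow> h differentiable (at y)"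
    and dh: "\<And>v. (\<lambda>y. D h y v) differentiable (at x)"
  shows "D (\<lambda>y. D h y v) x u = D (\<lambda>y. D h y u) x v"
proof -
  let ?a = "D (\<lambda>y. D h y v) x u" and ?b = "D (\<lambda>y. D h y u) x v"
  have "\<bar>?a - ?b\<bar> \<le> \<epsilon>" if \<epsilon>: "\<epsilon> > 0" for \<epsilon>
  proof -
    obtain d1 where d1: "d1 > 0" and 1: "\<And>t. 0 < t \<Longrightarrow> t < d1 \<Longrightarrow>
        \<bar>h (x + t *\<^sub>R u + t *\<^sub>R v) - h (x + t *\<^sub>R u) - h (x + t *\<^sub>R v) + h x - t\<^sup>2 * ?a\<bar> \<le> \<epsilon> / 2 * t\<^sup>2"
      using second_difference_quotient[OF S h dh half_gt_zero[OF \<epsilon>], of u v] by metis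
    obtain d2 where d2: "d2 > 0" and 2: "\<And>t. 0 < t \<Longrightarrow> t < d2 \<Longrightarrow>
        \<bar>h (x + t *\<^sub>R v + t *\<^sub>R u) - h (x + t *\<^sub>R v) - h (x + t *\<^sub>R u) + h x - t\<^sup>2 * ?b\<bar> \<le> \<epsilon> / 2 * t\<^sup>2"
      using second_difference_quotient[OF S h dh half_gt_zero[OF \<epsilon>], of v u] by metis
    define t where "t = min d1 d2 / 2"
    have t: "0 < t" "t < d1" "t < d2" using d1 d2 by (auto simp: t_def)
    have "\<bar>t\<^sup>2 * ?a - t\<^sup>2 * ?b\<bar> \<le> \<epsilon> * t\<^sup>2"
      using 1[OF t(1,2)] 2[OF t(1,3)] by (unfold add.assoc add.commute[of "t *\<^sub>R v" "t *\<^sub>R u"], linarith)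
    then have "t\<^sup>2 * \<bar>?a - ?b\<bar> \<le> t\<^sup>2 * \<epsilon>"
      by (simp add: right_diff_distrib[symmetric] abs_mult mult.commute)
    then show ?thesis using t by simp
  qed
  then have "\<bar>?a - ?b\<bar> \<le> 0" by (rule field_le_epsilon) auto
  then show ?thesis by simp
qed

text \<open>Otherwise the derivative along the line in direction \<open>v\<close>, being 0 at
  \<open>x\<close>, would be positive just after it, and \<open>h\<close> would rise above its
  maximum.\<close>

lemma second_derivative_at_max:
  fixes h :: "'a::real_normed_vector \<Rightarrow> real"
  assumes S: "open S" "x \<in> S" and h: "\<And>y. y \<in> S \<Longrightarrow> h differentiable (at y)"
    and dh: "(\<lambda>y. D h y v) differentiable (at x)"
    and max: "\<And>y. y \<in> S \<Longrightarrow> h y \<le> h x"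
  shows "D (\<lambda>y. D h y v) x v \<le> 0"
proof (rule ccontr)
  define \<phi> where "\<phi> s = h (x + s *\<^sub>R v)" for s
  define \<psi> where "\<psi> s = D h (x + s *\<^sub>R v) v" for s
  assume "\<not> ?thesis"
  moreover have "DERIV \<psi> 0 :> D (\<lambda>y. D h y v) x v"
    using DERIV_along_line[of "\<lambda>y. D h y v" x 0 v] dh by (simp add: \<psi>_def[abs_def])
  ultimately obtain d where d: "d > 0" "\<And>s. 0 < s \<Longrightarrow> s < d \<Longrightarrow> \<psi> 0 < \<psi> s"
    using DERIV_pos_inc_right[of \<psi> _ 0] by force
  obtain r where r: "r > 0" "ball x r \<subseteq> S" using S open_contains_ball by metis
  have "D h x = (\<lambda>v. 0)"
    using differential_zero_maxmin[OF S(2,1) D_has_derivative[OF h[OF S(2)]]] max by blast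
  then have \<psi>0: "\<psi> 0 = 0" by (simp add: \<psi>_def)
  define t where "t = min (d / 2) (r / (norm v + 1) / 2)"
  have nv: "norm v + 1 > 0" by (simp add: add_nonneg_pos)
  have "0 < t" using d(1) r(1) nv by (simp add: t_def)
  moreover have "t \<le> d / 2" by (simp only: t_def min.cobounded1)
  ultimately have t: "0 < t" "t < d" using d(1) by auto
  have "t \<le> r / (norm v + 1) / 2" by (simp add: t_def)
  then have tr: "t * (norm v + 1) < r" using r(1) nv by (simp add: field_simps)
  have inS: "x + s *\<^sub>R v \<in> S" if "0 \<le> s" "s \<le> t" for s
  proof (rule subsetD[OF r(2)])
    have "s * norm v \<le> t * (norm v + 1)" using that by (intro mult_mono) auto
    then show "x + s *\<^sub>R v \<in> ball x r" using tr that by (simp add: dist_norm)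
  qed
  have "DERIV \<phi> s :> \<psi> s" if "0 \<le> s \<and> s \<le> t" for s
    unfolding \<phi>_def \<psi>_def using that by (intro DERIV_along_line h inS) auto
  from MVT2[OF t(1), of \<phi>, OF this] obtain s where s: "0 < s" "s < t" "\<phi> t - \<phi> 0 = t * \<psi> s" by auto
  have "\<psi> s > 0" using d(2)[of s] s t \<psi>0 by simp
  then have "\<phi> t > \<phi> 0" using s t by (simp add: algebra_simps)
  then show False using max[OF inS[of t]] t by (simp add: \<phi>_def)
qed

lemma smooth_on_differentiable: "smooth_on S h \<Longrightarrow> x \<in> S \<Longrightarrow> h differentiable (at x)"
  unfolding smooth_on_def by (metis Ck_on.simps(2))

lemma smooth_on_D: "smooth_on S h \<Longrightarrow> smooth_on S (\<lambda>x. D h x v)"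
  unfolding smooth_on_def by (metis Ck_on.simps(2))

lemma smooth_on_continuous_on: "smooth_on S h \<Longrightarrow> continuous_on S h"
  unfolding smooth_on_def by (metis Ck_on.simps(1))

section \<open>Local Riemannian and Kaehler geometry\<close>

text \<open>Gives meaning to the \<open>THE\<close> in \<open>christoffel\<close>,
  \<open>gradient\<close> and \<open>normal_part\<close>: through the inner product \<open>B\<close>
  becomes an injective, hence surjective, endomorphism \<open>T\<close>.\<close>

lemma riesz_unique:
  fixes B :: "'e::euclidean_space \<Rightarrow> 'e \<Rightarrow> real"
  assumes bil: "bilinear B" and pos: "\<And>v. v \<noteq> 0 \<Longrightarrow> B v v > 0" and "linear h"
  shows "\<exists>!z. \<forall>u. B z u = h u"
proof -
  define T where "T v = (\<Sum>b\<in>Basis. B v b *\<^sub>R b)" for v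
  have Tin: "T v \<bullet> w = B v w" for v w
    using linear_expand_Basis[OF bilinear_linear(1)[OF bil], of v w]
    by (simp add: T_def inner_sum_left inner_sum_right inner_commute mult.commute)
  have linT: "linear T"
    using bil by (intro linearI) (simp_all add: T_def bilinear_ladd bilinear_lmul
      scaleR_left.add sum.distrib scaleR_right.sum scaleR_scaleR)
  have "inj T"
    using pos by (intro linear_injective_0[OF linT, THEN iffD2]) (metis Tin inner_zero_left less_irrefl)
  then have "surj T" by (rule linear_injective_imp_surjective[OF linT]) simp
  then obtain z where z: "T z = (\<Sum>b\<in>Basis. h b *\<^sub>R b)" by (metis surjD)
  have "B z u = h u" for u
    using linear_expand_Basis[OF \<open>linear h\<close>, of u]
    by (simp add: Tin[symmetric] z inner_sum_left inner_sum_right inner_commute mult.commute)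
  moreover have "z' = z" if "\<forall>u. B z' u = h u" for z'
    using pos[of "z' - z"] calculation that by (force simp: bilinear_lsub[OF bil])
  ultimately show ?thesis by metis
qed

locale local_metric =
  fixes G :: "'e::euclidean_space metric" and V :: "'e set"
  assumes open_V: "open V"
    and metric_bilinear: "x \<in> V \<Longrightarrow> bilinear (G x)"
    and metric_sym: "x \<in> V \<Longrightarrow> G x v w = G x w v"
    and metric_pos: "x \<in> V \<Longrightarrow> v \<noteq> 0 \<Longrightarrow> G x v v > 0"
    and smooth: "smooth_on V (\<lambda>x. G x v w)"
begin

abbreviation dG :: "'e \<Rightarrow> 'e \<Rightarrow> 'e \<Rightarrow> 'e \<Rightarrow> real" where
  "dG x u v w \<equiv> D (\<lambda>y. G y v w) x u"

abbreviation \<Gamma> :: "'e \<Rightarrow> 'e \<Rightarrow> 'e \<Rightarrow> 'e" where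
  "\<Gamma> \<equiv> christoffel G"

lemmas G_add_left = metric_bilinear[THEN bilinear_ladd]
lemmas G_add_right = metric_bilinear[THEN bilinear_radd]
lemmas G_diff_left = metric_bilinear[THEN bilinear_lsub]
lemmas G_diff_right = metric_bilinear[THEN bilinear_rsub]
lemmas G_minus_left = metric_bilinear[THEN bilinear_lneg]
lemmas G_minus_right = metric_bilinear[THEN bilinear_rneg]
lemmas G_scale_left = metric_bilinear[THEN bilinear_lmul]
lemmas G_scale_right = metric_bilinear[THEN bilinear_rmul]
lemmas G_simps = G_add_left G_add_right G_diff_left G_diff_right G_minus_left G_minus_right
  G_scale_left G_scale_right

lemma G_eqI:
  assumes "x \<in> V" "\<And>u. G x v u = G x w u"
  shows "v = w"
proof (rule ccontr)
  assume "v \<noteq> w"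
  then have "G x (v - w) (v - w) > 0" using metric_pos assms by simp
  then show False using assms by (simp add: G_diff_left)
qed

lemma G_differentiable: "x \<in> V \<Longrightarrow> (\<lambda>y. G y v w) differentiable (at x)"
  using smooth by (rule smooth_on_differentiable)

lemma dG_differentiable: "x \<in> V \<Longrightarrow> (\<lambda>y. dG y u v w) differentiable (at x)"
  using smooth_on_D[OF smooth] by (rule smooth_on_differentiable)

lemma linear_dG: "x \<in> V \<Longrightarrow> linear (\<lambda>u. dG x u v w)"
  using G_differentiable by (rule linear_frechet_derivative)

lemma dG_sym: "x \<in> V \<Longrightarrow> dG x u v w = dG x u w v"
  using D_cong[OF open_V, of x "\<lambda>y. G y v w" "\<lambda>y. G y w v"] metric_sym by simp

lemma linear_dG_right:
  assumes x: "x \<in> V"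
  shows "linear (\<lambda>w. dG x u v w)"
proof (rule linearI)
  fix w w' :: 'e and r :: real
  have "D (\<lambda>y. G y v (w + w')) x = D (\<lambda>y. G y v w + G y v w') x"
    using x by (intro D_cong[OF open_V]) (auto simp: G_add_right)
  also have "\<dots> = (\<lambda>u. dG x u v w + dG x u v w')"
    by (intro D_eq has_derivative_add D_has_derivative G_differentiable x)
  finally show "dG x u v (w + w') = dG x u v w + dG x u v w'" by simp
  have "D (\<lambda>y. G y v (r *\<^sub>R w)) x = D (\<lambda>y. r *\<^sub>R G y v w) x"
    using x by (intro D_cong[OF open_V]) (auto simp: G_scale_right)
  also have "\<dots> = (\<lambda>u. r *\<^sub>R dG x u v w)"
    by (intro D_eq has_derivative_scaleR_right D_has_derivative G_differentiable x)
  finally show "dG x u v (r *\<^sub>R w) = r *\<^sub>R dG x u v w" by simp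
qed

lemma linear_dG_middle: "x \<in> V \<Longrightarrow> linear (\<lambda>w. dG x u w v)"
  using linear_dG_right[of x v u] by (simp add: dG_sym[of x v])

lemma dG_add:
  assumes "x \<in> V"
  shows "dG x (u + u') v w = dG x u v w + dG x u' v w" "dG x u (v + v') w = dG x u v w + dG x u v' w"
    "dG x u v (w + w') = dG x u v w + dG x u v w'"
  using linear_add[OF linear_dG[OF assms]] linear_add[OF linear_dG_middle[OF assms]]
    linear_add[OF linear_dG_right[OF assms]] by blast+

lemma dG_scale:
  assumes "x \<in> V"
  shows "dG x (r *\<^sub>R u) v w = r * dG x u v w" "dG x u (r *\<^sub>R v) w = r * dG x u v w"
    "dG x u v (r *\<^sub>R w) = r * dG x u v w"
  using linear_cmul[OF linear_dG[OF assms]] linear_cmul[OF linear_dG_middle[OF assms]]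
    linear_cmul[OF linear_dG_right[OF assms]] by (metis real_scaleR_def)+

lemma christoffel_eq:
  assumes x: "x \<in> V"
  shows "2 * G x (\<Gamma> x v w) u = dG x v w u + dG x w v u - dG x u v w"
proof -
  define h where "h u = (dG x v w u + dG x w v u - dG x u v w) / 2" for u
  have "linear h" unfolding h_def
    by (intro linearI) (simp_all add: dG_add[OF x] dG_scale[OF x] field_simps)
  from riesz_unique[OF metric_bilinear[OF x] metric_pos[OF x] this]
  have "\<exists>!z. \<forall>u. 2 * G x z u = dG x v w u + dG x w v u - dG x u v w"
    by (simp add: h_def field_simps)
  from theI'[OF this] show ?thesis unfolding christoffel_def by blast
qed

lemma christoffel_sym: "x \<in> V \<Longrightarrow> \<Gamma> x v w = \<Gamma> x w v"
proof (rule G_eqI)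
  fix u
  assume x: "x \<in> V"
  show "G x (\<Gamma> x v w) u = G x (\<Gamma> x w v) u"
    using christoffel_eq[OF x, of v w u] christoffel_eq[OF x, of w v u] dG_sym[OF x, of v w u] by linarith
qed

lemma christoffel_metric:
  assumes "x \<in> V"
  shows "dG x u v w = G x (\<Gamma> x u v) w + G x v (\<Gamma> x u w)"
  using christoffel_eq[OF assms, of u v w] christoffel_eq[OF assms, of u w v]
    metric_sym[OF assms, of v "\<Gamma> x u w"] dG_sym[OF assms, of v w u] by linarith

lemma christoffel_differentiable:
  assumes "x \<in> V"
  shows "(\<lambda>y. \<Gamma> y v w) differentiable (at x)"
proof (rule solution_differentiable[OF open_V assms metric_bilinear metric_pos[OF assms] G_differentiable[OF assms]])
  show "G y (\<Gamma> y v w) u = (dG y v w u + dG y w v u - dG y u v w) / 2" if "y \<in> V" for y u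
    using christoffel_eq[OF that, of v w u] by simp
  show "(\<lambda>y. (dG y v w u + dG y w v u - dG y u v w) / 2) differentiable (at x)" for u
    using dG_differentiable[OF assms]
    by (intro differentiable_divide differentiable_diff differentiable_add) auto
qed

lemma bilinear_christoffel:
  assumes x: "x \<in> V"
  shows "bilinear (\<Gamma> x)"
proof -
  have "linear (\<lambda>w. \<Gamma> x v w)" for v
  proof (rule linearI; rule G_eqI[OF x])
    fix w w' u and r :: real
    show "G x (\<Gamma> x v (w + w')) u = G x (\<Gamma> x v w + \<Gamma> x v w') u"
      using christoffel_eq[OF x, of v w u] christoffel_eq[OF x, of v w' u] christoffel_eq[OF x, of v "w + w'" u]
      by (simp add: G_add_left[OF x] dG_add[OF x])
    have "2 * G x (\<Gamma> x v (r *\<^sub>R w)) u = r * (2 * G x (\<Gamma> x v w) u)"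
      unfolding christoffel_eq[OF x] by (simp add: dG_scale[OF x] algebra_simps)
    then show "G x (\<Gamma> x v (r *\<^sub>R w)) u = G x (r *\<^sub>R \<Gamma> x v w) u"
      by (simp add: G_scale_left[OF x])
  qed
  then show ?thesis
    using christoffel_sym[OF x] by (simp add: bilinear_def)
qed

lemma riemann_anti: "riemann G x u v w = - riemann G x v u w"
  by (simp add: riemann_def)

lemma riemann_bianchi:
  assumes x: "x \<in> V"
  shows "riemann G x u v w + riemann G x v w u + riemann G x w u v = 0"
proof -
  have "D (\<lambda>y. \<Gamma> y a b) x = D (\<lambda>y. \<Gamma> y b a) x" for a b
    using x by (intro D_cong[OF open_V]) (auto simp: christoffel_sym)
  then show ?thesis
    unfolding riemann_def christoffel_sym[OF x, of w u] christoffel_sym[OF x, of v u] christoffel_sym[OF x, of w v]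
    by (simp add: algebra_simps)
qed

lemma D_metric_christoffel:
  assumes x: "x \<in> V"
  shows "D (\<lambda>y. dG y v w z) x u =
    dG x u (\<Gamma> x v w) z + G x (D (\<lambda>y. \<Gamma> y v w) x u) z
    + dG x u w (\<Gamma> x v z) + G x w (D (\<lambda>y. \<Gamma> y v z) x u)"
proof -
  note d = bilinear_family_has_derivative[OF open_V x metric_bilinear G_differentiable[OF x]]
  note g = D_has_derivative[OF christoffel_differentiable[OF x]]
  have "((\<lambda>y. G y (\<Gamma> y v w) z) has_derivative
     (\<lambda>u. dG x u (\<Gamma> x v w) z + G x (D (\<lambda>y. \<Gamma> y v w) x u) z)) (at x)"
    using d[OF _ g[of v w] has_derivative_const[of z]] by (simp add: bilinear_rzero[OF metric_bilinear[OF x]])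
  moreover have "((\<lambda>y. G y w (\<Gamma> y v z)) has_derivative
     (\<lambda>u. dG x u w (\<Gamma> x v z) + G x w (D (\<lambda>y. \<Gamma> y v z) x u))) (at x)"
    using d[OF _ has_derivative_const[of w] g[of v z]] by (simp add: bilinear_lzero[OF metric_bilinear[OF x]])
  ultimately have *: "((\<lambda>y. G y (\<Gamma> y v w) z + G y w (\<Gamma> y v z)) has_derivative
     (\<lambda>u. dG x u (\<Gamma> x v w) z + G x (D (\<lambda>y. \<Gamma> y v w) x u) z
       + (dG x u w (\<Gamma> x v z) + G x w (D (\<lambda>y. \<Gamma> y v z) x u)))) (at x)"
    by (rule has_derivative_add)
  have "D (\<lambda>y. dG y v w z) x = D (\<lambda>y. G y (\<Gamma> y v w) z + G y w (\<Gamma> y v z)) x"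
    using x by (intro D_cong[OF open_V]) (auto simp: christoffel_metric)
  then show ?thesis using D_eq[OF *] by simp
qed

text \<open>The metric is parallel, so the curvature acts on it by zero: this is the symmetry of the
  second derivatives of \<open>G\<close>, written out by
  \<open>D_metric_christoffel\<close>.\<close>

lemma riemann_anti_right:
  assumes x: "x \<in> V"
  shows "G x (riemann G x u v w) z = - G x w (riemann G x u v z)"
proof -
  have "D (\<lambda>y. dG y v w z) x u = D (\<lambda>y. dG y u w z) x v"
    by (rule second_derivative_symmetric[OF open_V x G_differentiable dG_differentiable[OF x]])
  then show ?thesis
    unfolding D_metric_christoffel[OF x] christoffel_metric[OF x] riemann_def
    by (simp add: G_simps[OF x])
qed

lemma riemann_pair_sym:
  assumes x: "x \<in> V"
  shows "G x (riemann G x u v w) z = G x (riemann G x w z u) v"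
proof -
  define r where "r a b c d = G x (riemann G x a b c) d" for a b c d
  have 1: "r a b c d = - r b a c d" for a b c d
    unfolding r_def by (subst riemann_anti) (simp add: G_simps[OF x])
  have 2: "r a b c d = - r a b d c" for a b c d
    unfolding r_def by (subst riemann_anti_right[OF x]) (simp add: metric_sym[OF x])
  have 3: "r a b c d + r b c a d + r c a b d = 0" for a b c d
    unfolding r_def using riemann_bianchi[OF x, of a b c]
    by (simp flip: G_add_left[OF x] add: bilinear_lzero[OF metric_bilinear[OF x]])
  \<comment> \<open>Milnor's octahedron: the Bianchi identity for the four cyclic shifts of
    \<open>u v w z\<close>. The other facts only bring the terms into a common form by the two skew
    symmetries.\<close>
  show ?thesis
    using 3[of u v w z] 3[of v w z u] 3[of w z u v] 3[of z u v w]
      1[of u v w z] 1[of v w u z] 1[of w u v z] 1[of z u v w] 1[of z v w u] 1[of z w u v]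
      2[of u v w z] 2[of v w u z] 2[of w u v z] 2[of u z v w] 2[of v z w u] 2[of w z u v]
      1[of u z v w] 1[of v z w u] 1[of w z u v] 2[of w z v u] 2[of z u v w] 2[of v w z u] 2[of u w v z]
      1[of u w v z] 1[of u w z v] 2[of u w z v] 2[of z v u w] 1[of z v u w] 1[of v z u w]
    unfolding r_def[symmetric] by linarith
qed

lemma gradient_eq:
  assumes "x \<in> V" "h differentiable (at x)"
  shows "G x (gradient G h x) u = D h x u"
  using theI'[OF riesz_unique[OF metric_bilinear[OF assms(1)] metric_pos[OF assms(1)] linear_frechet_derivative[OF assms(2)]]]
  unfolding gradient_def by blast

lemma hessian_sym:
  assumes "x \<in> V" "smooth_on V h"
  shows "hessian G h x v w = hessian G h x w v"
  unfolding hessian_def christoffel_sym[OF assms(1), of v w]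
  using second_derivative_symmetric[OF open_V assms(1), of h w v]
    smooth_on_differentiable[OF assms(2)] smooth_on_differentiable[OF smooth_on_D[OF assms(2)] assms(1)]
  by simp

lemma hessian_minus_right:
  assumes "x \<in> V" "smooth_on V h"
  shows "hessian G h x v (- w) = - hessian G h x v w"
proof -
  have lin: "linear (D h y)" if "y \<in> V" for y
    using smooth_on_differentiable[OF assms(2) that] by (rule linear_frechet_derivative)
  have "D (\<lambda>y. D h y (- w)) x = D (\<lambda>y. - D h y w) x"
    using assms by (intro D_cong[OF open_V]) (auto simp: linear_neg[OF lin])
  also have "\<dots> = (\<lambda>v. - D (\<lambda>y. D h y w) x v)"
    by (intro D_eq has_derivative_minus D_has_derivative smooth_on_differentiable[OF smooth_on_D, where S = V] assms)
  finally show ?thesis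
    by (simp add: hessian_def bilinear_rneg[OF bilinear_christoffel] linear_neg[OF lin] assms)
qed

end

section \<open>Complex structure and curvature of a Kaehler metric\<close>

lemma J_J: "J (J v) = - v"
  by (simp add: J_def vec_eq_iff flip: mult.assoc)

lemma linear_J: "linear J"
  by (intro linearI) (simp_all add: J_def vec_eq_iff algebra_simps)

lemma J_inner: "J v \<bullet> J w = v \<bullet> w"
  by (simp add: J_def inner_vec_def inner_complex_def add.commute)

lemma J_inner_left: "J v \<bullet> w = - (v \<bullet> J w)"
  using J_inner[of v "J w"] by (simp add: J_J)

text \<open>\<open>J\<close> sends \<open>axis i 1\<close> to \<open>axis i \<i>\<close> and that to
  \<open>- axis i 1\<close>, hence permutes the basis up to signs, which an even \<open>q\<close>
  ignores.\<close>

lemma sum_Basis_J: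
  fixes q :: "complex^'n \<Rightarrow> real"
  assumes even: "\<And>v. q (- v) = q v"
  shows "(\<Sum>b\<in>Basis. q (J b)) = (\<Sum>b\<in>Basis. q b)"
proof -
  have sum: "(\<Sum>b\<in>Basis. p b) = (\<Sum>i\<in>UNIV. p (axis i 1) + p (axis i \<i>))" for p :: "complex^'n \<Rightarrow> real"
  proof -
    have "(\<Sum>b\<in>Basis. p b) = (\<Sum>b\<in>(\<Union>i. {axis i 1, axis i \<i>}). p b)"
      by (rule sum.cong) (auto simp: Basis_vec_def Basis_complex_def)
    also have "\<dots> = (\<Sum>i\<in>UNIV. \<Sum>b\<in>{axis i 1, axis i \<i>}. p b)"
      by (rule sum.UNION_disjoint) (auto simp: axis_eq_axis)
    also have "\<dots> = (\<Sum>i\<in>UNIV. p (axis i 1) + p (axis i \<i>))"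
      by (intro sum.cong) (auto simp: axis_eq_axis)
    finally show ?thesis .
  qed
  have "J (axis i 1) = axis i \<i>" "J (axis i \<i>) = - axis i 1" for i :: 'n
    by (auto simp: J_def axis_def vec_eq_iff)
  then show ?thesis by (simp add: sum even add.commute)
qed

locale local_kahler = local_metric G V for G :: "(complex^'n) metric" and V +
  assumes hermitian: "x \<in> V \<Longrightarrow> G x (J v) (J w) = G x v w"
    and closed: "x \<in> V \<Longrightarrow> d_two_form (kahler_form G) x u v w = 0"
begin

lemma G_J_left: "x \<in> V \<Longrightarrow> G x (J v) w = - G x v (J w)"
  using hermitian[of x v "J w"] by (simp add: J_J G_minus_right)

lemma dG_J_left:
  assumes "x \<in> V"
  shows "dG x u (J v) w = - dG x u v (J w)"
proof -
  have "D (\<lambda>y. G y (J v) w) x = D (\<lambda>y. - G y v (J w)) x"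
    using assms by (intro D_cong[OF open_V]) (auto simp: G_J_left)
  also have "\<dots> = (\<lambda>u. - dG x u v (J w))"
    by (intro D_eq has_derivative_minus D_has_derivative G_differentiable assms)
  finally show ?thesis by simp
qed

text \<open>This is the parallelism of the complex structure: in a holomorphic chart
  \<open>J\<close> is constant, so only the Christoffel part of its covariant derivative is
  left.\<close>

lemma christoffel_J:
  assumes x: "x \<in> V"
  shows "\<Gamma> x v (J w) = J (\<Gamma> x v w)"
proof (rule G_eqI[OF x])
  fix u
  \<comment> \<open>The Kaehler form is closed. By the Koszul formula the two sides differ by a
    combination of the instances for \<open>v, w, u\<close> and \<open>v, J w, J u\<close>.\<close>
  have cyc: "dG x a (J b) c + dG x b (J c) a + dG x c (J a) b = 0" for a b c
    using closed[OF x, of a b c] by (simp add: d_two_form_def kahler_form_def)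
  have JJ: "dG x a (J b) (J c) = dG x a b c" "dG x a b (J (J c)) = - dG x a b c" for a b c
    using linear_neg[OF linear_dG_right[OF x]] by (simp_all add: dG_J_left[OF x] J_J)
  have "dG x w v (J u) = - dG x w u (J v)"
    by (metis dG_J_left[OF x] dG_sym[OF x])
  then have "2 * G x (\<Gamma> x v (J w)) u = 2 * G x (J (\<Gamma> x v w)) u"
    unfolding G_J_left[OF x] mult_minus_right christoffel_eq[OF x]
    using cyc[of v w u] cyc[of v "J w" "J u"]
    by (simp add: dG_J_left[OF x] JJ dG_sym[OF x, of w v] dG_sym[OF x, of u v])
  then show "G x (\<Gamma> x v (J w)) u = G x (J (\<Gamma> x v w)) u" by simp
qed

lemma riemann_J:
  assumes x: "x \<in> V"
  shows "riemann G x u v (J w) = J (riemann G x u v w)"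
proof -
  have "D (\<lambda>y. \<Gamma> y a (J w)) x b = J (D (\<lambda>y. \<Gamma> y a w) x b)" for a b
  proof -
    have "D (\<lambda>y. \<Gamma> y a (J w)) x = D (\<lambda>y. J (\<Gamma> y a w)) x"
      using x by (intro D_cong[OF open_V]) (auto simp: christoffel_J)
    also have "\<dots> = (\<lambda>b. J (D (\<lambda>y. \<Gamma> y a w) x b))"
      by (intro D_eq bounded_linear.has_derivative[OF linear_J[unfolded linear_conv_bounded_linear]]
        D_has_derivative christoffel_differentiable x)
    finally show ?thesis by simp
  qed
  then show ?thesis
    by (simp add: riemann_def christoffel_J[OF x] linear_add[OF linear_J] linear_diff[OF linear_J])
qed

text \<open>Pair symmetry carries the \<open>J\<close>-invariance in the last two arguments, which
  follows from \<open>riemann_J\<close> and \<open>hermitian\<close>, over to the first two.\<close>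

lemma riemann_J_J:
  assumes x: "x \<in> V"
  shows "riemann G x (J u) (J v) w = riemann G x u v w"
proof (rule G_eqI[OF x])
  fix z
  have "G x (riemann G x (J u) (J v) w) z = G x (riemann G x w z (J u)) (J v)"
    by (rule riemann_pair_sym[OF x])
  also have "\<dots> = G x (riemann G x w z u) v"
    by (simp add: riemann_J[OF x] hermitian[OF x])
  also have "\<dots> = G x (riemann G x u v w) z"
    by (rule riemann_pair_sym[OF x, symmetric])
  finally show "G x (riemann G x (J u) (J v) w) z = G x (riemann G x u v w) z" .
qed

text \<open>\<open>riemann_pair_sym\<close> moves \<open>v\<close> into the second argument of
  \<open>G\<close>, where the sign comes out; this spares differentiating the linearity of
  \<open>christoffel\<close>.\<close>

lemma riemann_minus:
  assumes x: "x \<in> V"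
  shows "riemann G x (- u) v w = - riemann G x u v w" "riemann G x u (- v) w = - riemann G x u v w"
proof -
  show *: "riemann G x u (- v) w = - riemann G x u v w" for u v
    by (rule G_eqI[OF x]) (simp only: G_minus_left[OF x] G_minus_right[OF x] riemann_pair_sym[OF x, of u _ w])
  show "riemann G x (- u) v w = - riemann G x u v w"
    by (subst (1 2) riemann_anti) (simp add: *)
qed

text \<open>\<open>J\<close> is an isometry also of the Euclidean inner product through which
  \<open>ricci\<close> takes its trace. So \<open>J\<close> can be moved from \<open>v\<close> and
  \<open>w\<close> onto the basis vectors, which it merely permutes up to sign.\<close>

lemma ricci_J:
  assumes x: "x \<in> V"
  shows "ricci G x (J v) (J w) = ricci G x v w"
proof -
  have R: "riemann G x u (J v) w = - riemann G x (J u) v w" for u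
    using riemann_J_J[OF x, of u "J v" w] by (simp add: J_J riemann_minus[OF x])
  have "ricci G x (J v) (J w) = (\<Sum>b\<in>Basis. riemann G x (J b) v w \<bullet> J b)"
    by (simp add: ricci_def riemann_J[OF x] R J_inner_left)
  also have "\<dots> = ricci G x v w"
    unfolding ricci_def by (rule sum_Basis_J) (simp add: riemann_minus[OF x])
  finally show ?thesis .
qed

text \<open>The Hessian inherits the \<open>J\<close>-invariance of \<open>ricci\<close> and
  \<open>G\<close>; together with its symmetry this makes \<open>hessian G h x v (J w)\<close>
  alternating in \<open>v\<close> and \<open>w\<close>, so that its trace against a symmetric matrix
  vanishes.\<close>

lemma soliton_hessian_anti:
  assumes x: "x \<in> V" and h: "smooth_on V h"
    and soliton: "\<And>v w. ricci G x v w + hessian G h x v w - 1/2 * G x v w = 0"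
  shows "hessian G h x v (J w) = - hessian G h x w (J v)"
proof -
  have "hessian G h x v (J w) = hessian G h x (J v) (J (J w))"
    using soliton[of v "J w"] soliton[of "J v" "J (J w)"] by (simp add: ricci_J[OF x] hermitian[OF x])
  then show ?thesis
    by (simp add: J_J hessian_minus_right[OF x h] hessian_sym[OF x h, of "J v"])
qed

end

section \<open>The strong maximum principle\<close>

lemma linear_expand_axis:
  fixes L :: "real^'n \<Rightarrow> 'g::real_vector"
  assumes "linear L"
  shows "L v = (\<Sum>i\<in>UNIV. v $ i *\<^sub>R L (axis i 1))"
proof -
  interpret linear L by fact
  have "L v = L (\<Sum>i\<in>UNIV. v $ i *\<^sub>R axis i 1)"
    by (simp add: basis_expansion flip: scalar_mult_eq_scaleR)
  then show ?thesis by (simp add: sum scale)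
qed

text \<open>By induction on the index set, splitting off a Schur complement.\<close>

lemma sum_mult_posdef_nonneg:
  fixes q M :: "'i \<Rightarrow> 'i \<Rightarrow> real"
  assumes "finite I"
    and "\<And>i j. q i j = q j i"
    and "\<And>c. \<exists>i\<in>I. c i \<noteq> 0 \<Longrightarrow> 0 < (\<Sum>i\<in>I. \<Sum>j\<in>I. q i j * c i * c j)"
    and "\<And>c. 0 \<le> (\<Sum>i\<in>I. \<Sum>j\<in>I. M i j * c i * c j)"
  shows "0 \<le> (\<Sum>i\<in>I. \<Sum>j\<in>I. q i j * M i j)"
  using assms
proof (induction I arbitrary: q rule: finite_induct)
  case (insert k I)
  have split: "(\<Sum>i\<in>insert k I. \<Sum>j\<in>insert k I. F i j) =
      F k k + (\<Sum>j\<in>I. F k j) + (\<Sum>i\<in>I. F i k) + (\<Sum>i\<in>I. \<Sum>j\<in>I. F i j)" for F :: "'i \<Rightarrow> 'i \<Rightarrow> real"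
    using insert.hyps by (simp add: sum.distrib)
  define d where "d = q k k"
  have "0 < (\<Sum>i\<in>insert k I. \<Sum>j\<in>insert k I. q i j * (if i = k then 1 else 0) * (if j = k then 1 else 0))"
    by (rule insert.prems(2)) auto
  also have "\<dots> = d"
  proof -
    have "(\<Sum>j\<in>I. F j * (if j = k then 1 else 0)) = 0" for F :: "'i \<Rightarrow> real"
      by (rule sum.neutral) (use insert.hyps in auto)
    then show ?thesis by (simp add: split d_def)
  qed
  finally have d: "d > 0" .
  define q' where "q' i j = q i j - q k i * q k j / d" for i j
  have q'k: "q' k j = 0" "q' j k = 0" for j
    using d insert.prems(1)[of j k] by (simp_all add: q'_def d_def)
  have "0 \<le> (\<Sum>i\<in>I. \<Sum>j\<in>I. q' i j * M i j)"
  proof (rule insert.IH)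
    show "q' i j = q' j i" for i j
      using insert.prems(1)[of i j] by (simp add: q'_def mult.commute)
    show "0 < (\<Sum>i\<in>I. \<Sum>j\<in>I. q' i j * c i * c j)" if c: "\<exists>i\<in>I. c i \<noteq> 0" for c
    proof -
      define s where "s = (\<Sum>i\<in>I. q k i * c i)"
      \<comment> \<open>The coordinate at \<open>k\<close> that minimises the form of
        \<open>q\<close> for the given other coordinates; the minimum is the form of
        \<open>q'\<close>.\<close>
      define c' where "c' = c(k := - s / d)"
      have c'I: "c' i = c i" if "i \<in> I" for i using that insert.hyps by (auto simp: c'_def)
      have "0 < (\<Sum>i\<in>insert k I. \<Sum>j\<in>insert k I. q i j * c' i * c' j)"
        using c c'I by (intro insert.prems(2)) fastforce
      also have "\<dots> = d * c' k * c' k + c' k * s + c' k * s + (\<Sum>i\<in>I. \<Sum>j\<in>I. q i j * c i * c j)"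
      proof -
        have "(\<Sum>j\<in>I. q k j * c' k * c' j) = c' k * s"
          unfolding s_def sum_distrib_left by (intro sum.cong refl) (simp add: c'I)
        moreover have "q i k * c' i * c' k = c' k * (q k i * c i)" if "i \<in> I" for i
          using insert.prems(1)[of i k] c'I[OF that] by simp
        then have "(\<Sum>i\<in>I. q i k * c' i * c' k) = c' k * s"
          unfolding s_def sum_distrib_left by (intro sum.cong refl)
        moreover have "(\<Sum>i\<in>I. \<Sum>j\<in>I. q i j * c' i * c' j) = (\<Sum>i\<in>I. \<Sum>j\<in>I. q i j * c i * c j)"
          by (intro sum.cong refl) (simp add: c'I)
        ultimately show ?thesis unfolding split d_def by simp
      qed
      also have "\<dots> = (\<Sum>i\<in>I. \<Sum>j\<in>I. q i j * c i * c j) - s * s / d"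
        using d by (simp add: c'_def field_simps)
      also have "s * s / d = (\<Sum>i\<in>I. \<Sum>j\<in>I. q k i * q k j / d * c i * c j)"
        unfolding s_def sum_product by (simp add: sum_divide_distrib mult_ac)
      also have "(\<Sum>i\<in>I. \<Sum>j\<in>I. q i j * c i * c j) - \<dots> = (\<Sum>i\<in>I. \<Sum>j\<in>I. q' i j * c i * c j)"
        by (simp add: q'_def left_diff_distrib sum_subtractf)
      finally show ?thesis .
    qed
    show "0 \<le> (\<Sum>i\<in>I. \<Sum>j\<in>I. M i j * c i * c j)" for c
    proof -
      have "0 \<le> (\<Sum>i\<in>insert k I. \<Sum>j\<in>insert k I. M i j * (c(k := 0)) i * (c(k := 0)) j)"
        by (rule insert.prems(3))
      also have "\<dots> = (\<Sum>i\<in>I. \<Sum>j\<in>I. M i j * c i * c j)"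
        unfolding split using insert.hyps by (auto intro!: sum.cong)
      finally show ?thesis .
    qed
  qed
  also have "\<dots> = (\<Sum>i\<in>insert k I. \<Sum>j\<in>insert k I. q' i j * M i j)"
    unfolding split by (simp add: q'k)
  \<comment> \<open>\<open>q\<close> is \<open>q'\<close> plus a rank one matrix, whose pairing with
    \<open>M\<close> is the quadratic form of \<open>M\<close> at the row \<open>q k\<close>,
    divided by \<open>d\<close>.\<close>
  also have "\<dots> = (\<Sum>i\<in>insert k I. \<Sum>j\<in>insert k I. q i j * M i j)
      - (\<Sum>i\<in>insert k I. \<Sum>j\<in>insert k I. M i j * q k i * q k j) / d"
    by (simp only: q'_def left_diff_distrib sum_subtractf sum_divide_distrib) (simp add: mult_ac)
  also have "\<dots> \<le> (\<Sum>i\<in>insert k I. \<Sum>j\<in>insert k I. q i j * M i j)"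
    using insert.prems(3)[of "q k"] d by simp
  finally show ?case .
qed simp

lemma second_derivative_expand_axis:
  fixes w :: "real^'n \<Rightarrow> real"
  assumes U: "open U" "x \<in> U" and w: "\<And>y. y \<in> U \<Longrightarrow> w differentiable (at y)"
    and dw: "\<And>v. (\<lambda>y. D w y v) differentiable (at x)"
  shows "D (\<lambda>y. D w y v) x u = (\<Sum>i\<in>UNIV. \<Sum>j\<in>UNIV. u $ i * v $ j * D (\<lambda>y. D w y (axis j 1)) x (axis i 1))"
proof -
  have "D (\<lambda>y. D w y v) x = D (\<lambda>y. \<Sum>j\<in>UNIV. v $ j *\<^sub>R D w y (axis j 1)) x"
    using linear_expand_axis[OF linear_frechet_derivative[OF w]] by (intro D_cong[OF U]) auto
  also have "\<dots> = (\<lambda>u. \<Sum>j\<in>UNIV. v $ j *\<^sub>R D (\<lambda>y. D w y (axis j 1)) x u)"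
    by (intro D_eq has_derivative_sum has_derivative_scaleR_right D_has_derivative dw)
  finally have "D (\<lambda>y. D w y v) x u = (\<Sum>j\<in>UNIV. v $ j * D (\<lambda>y. D w y (axis j 1)) x u)"
    by simp
  also have "\<dots> = (\<Sum>j\<in>UNIV. \<Sum>i\<in>UNIV. u $ i * v $ j * D (\<lambda>y. D w y (axis j 1)) x (axis i 1))"
    by (subst linear_expand_axis[OF linear_frechet_derivative[OF dw], of _ u])
      (simp add: sum_distrib_left mult_ac)
  also have "\<dots> = (\<Sum>i\<in>UNIV. \<Sum>j\<in>UNIV. u $ i * v $ j * D (\<lambda>y. D w y (axis j 1)) x (axis i 1))"
    by (rule sum.swap)
  finally show ?thesis .
qed

lemma axis_nth: "axis i x $ j = (if j = i then x else 0)"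
  by (simp add: axis_def)

text \<open>Minus the Hessian is positive semidefinite at a maximum; pairing it with
  \<open>q\<close> by \<open>sum_mult_posdef_nonneg\<close> avoids a diagonalisation.\<close>

lemma elliptic_at_max:
  fixes w :: "real^'n \<Rightarrow> real"
  assumes U: "open U" "x \<in> U" and w: "\<And>y. y \<in> U \<Longrightarrow> w differentiable (at y)"
    and dw: "\<And>v. (\<lambda>y. D w y v) differentiable (at x)"
    and max: "\<And>y. y \<in> U \<Longrightarrow> w y \<le> w x"
    and sym: "\<And>i j. q i j = q j i"
    and pos: "\<And>\<xi> :: real^'n. \<xi> \<noteq> 0 \<Longrightarrow> 0 < (\<Sum>i\<in>UNIV. \<Sum>j\<in>UNIV. q i j * \<xi> $ i * \<xi> $ j)"
  shows "(\<Sum>i\<in>UNIV. \<Sum>j\<in>UNIV. q i j * D (\<lambda>y. D w y (axis j 1)) x (axis i 1)) \<le> 0"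
proof -
  have "0 \<le> (\<Sum>i\<in>UNIV. \<Sum>j\<in>UNIV. q i j * - D (\<lambda>y. D w y (axis j 1)) x (axis i 1))"
  proof (rule sum_mult_posdef_nonneg[OF _ sym])
    show "0 < (\<Sum>i\<in>UNIV. \<Sum>j\<in>UNIV. q i j * c i * c j)" if "\<exists>i\<in>UNIV. c i \<noteq> 0" for c
      using pos[of "\<chi> i. c i"] that by (auto simp: vec_eq_iff)
    show "0 \<le> (\<Sum>i\<in>UNIV. \<Sum>j\<in>UNIV. - D (\<lambda>y. D w y (axis j 1)) x (axis i 1) * c i * c j)" for c
    proof -
      have "D (\<lambda>y. D w y (\<chi> i. c i)) x (\<chi> i. c i) \<le> 0"
        by (rule second_derivative_at_max[OF U w dw max])
      also have "D (\<lambda>y. D w y (\<chi> i. c i)) x (\<chi> i. c i) =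
          (\<Sum>i\<in>UNIV. \<Sum>j\<in>UNIV. D (\<lambda>y. D w y (axis j 1)) x (axis i 1) * c i * c j)"
        using second_derivative_expand_axis[OF U w dw, of "\<chi> i. c i" "\<chi> i. c i"] by (simp add: mult_ac)
      finally show ?thesis by (simp add: sum_negf)
    qed
  qed simp
  then show ?thesis by (simp add: sum_negf)
qed

text \<open>The barrier of Hopf's argument. \<open>h x + k\<close> is the exponential itself, a
  positive factor common to all derivatives.\<close>

lemma gaussian_derivatives:
  fixes c :: "'a::euclidean_space" and \<alpha> k :: real
  defines "h \<equiv> (\<lambda>x. exp (- \<alpha> * ((x - c) \<bullet> (x - c))) - k)"
  shows "(h has_derivative (\<lambda>v. - 2 * \<alpha> * ((x - c) \<bullet> v) * (h x + k))) (at x)"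
    and "D h x v = - 2 * \<alpha> * ((x - c) \<bullet> v) * (h x + k)"
    and "((\<lambda>x. D h x v) has_derivative (\<lambda>w.
      (4 * \<alpha>\<^sup>2 * ((x - c) \<bullet> v) * ((x - c) \<bullet> w) - 2 * \<alpha> * (w \<bullet> v)) * (h x + k))) (at x)"
proof -
  show 1: "(h has_derivative (\<lambda>v. - 2 * \<alpha> * ((x - c) \<bullet> v) * (h x + k))) (at x)" for x
    unfolding h_def by (auto intro!: derivative_eq_intros simp: inner_commute algebra_simps)
  show 2: "D h x v = - 2 * \<alpha> * ((x - c) \<bullet> v) * (h x + k)" for x v
    by (simp add: D_eq[OF 1])
  show "((\<lambda>x. D h x v) has_derivative (\<lambda>w.
      (4 * \<alpha>\<^sup>2 * ((x - c) \<bullet> v) * ((x - c) \<bullet> w) - 2 * \<alpha> * (w \<bullet> v)) * (h x + k))) (at x)"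
    unfolding 2 by (auto intro!: derivative_eq_intros 1 simp: power2_eq_square algebra_simps)
qed

text \<open>E. Hopf's argument: if \<open>u\<close> were smaller than its maximum \<open>u p\<close> somewhere near \<open>p\<close>, there would
  be a ball \<open>cball c R\<close> on which the maximum is attained only at a boundary point \<open>y\<close>.  Adding
  a small multiple of a function \<open>h\<close> that is negative outside this ball and strictly subelliptic
  near \<open>y\<close> would produce an interior maximum near \<open>y\<close>.\<close>

lemma strong_maximum_principle_local:
  fixes u :: "real^'n \<Rightarrow> real" and a :: "real^'n \<Rightarrow> 'n \<Rightarrow> 'n \<Rightarrow> real" and b :: "real^'n \<Rightarrow> real^'n"
  assumes U: "open U" "p \<in> U"
    and a_cont: "\<And>i j. continuous_on U (\<lambda>x. a x i j)"
    and a_sym: "\<And>x i j. x \<in> U \<Longrightarrow> a x i j = a x j i"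
    and a_pos: "\<And>x \<xi>. x \<in> U \<Longrightarrow> \<xi> \<noteq> 0 \<Longrightarrow> 0 < (\<Sum>i\<in>UNIV. \<Sum>j\<in>UNIV. a x i j * \<xi> $ i * \<xi> $ j)"
    and b_cont: "continuous_on U b"
    and u: "smooth_on U u"
    and eq: "\<And>x. x \<in> U \<Longrightarrow>
      (\<Sum>i\<in>UNIV. \<Sum>j\<in>UNIV. a x i j * D (\<lambda>y. D u y (axis j 1)) x (axis i 1)) = D u x (b x)"
    and max: "\<And>x. x \<in> U \<Longrightarrow> u x \<le> u p"
  shows "\<exists>r>0. \<forall>x\<in>ball p r. u x = u p"
proof -
  obtain \<rho> where \<rho>: "\<rho> > 0" "ball p \<rho> \<subseteq> U" using U open_contains_ball by metis
  have cu: "continuous_on U u" using u by (rule smooth_on_continuous_on)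
  \<comment> \<open>Half the radius, so that the closed ball around \<open>x0\<close> through
    \<open>p\<close> stays inside \<open>ball p \<rho>\<close>.\<close>
  have "u x0 = u p" if x0: "x0 \<in> ball p (\<rho> / 2)" for x0
  proof (rule ccontr)
    assume neq: "u x0 \<noteq> u p"
    have sub: "cball x0 (dist x0 p) \<subseteq> ball p \<rho>"
    proof
      fix z assume "z \<in> cball x0 (dist x0 p)"
      then show "z \<in> ball p \<rho>"
        using x0 dist_triangle[of p z x0] by (simp add: dist_commute)
    qed
    define Z where "Z = {z \<in> cball x0 (dist x0 p). u z = u p}"
    have "closed Z" unfolding Z_def
      using continuous_on_subset[OF cu] sub \<rho>(2)
      by (intro continuous_closed_preimage_constant) auto
    moreover have "p \<in> Z" by (simp add: Z_def)
    \<comment> \<open>A maximum point nearest to \<open>x0\<close>: \<open>u\<close> is below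
      \<open>u p\<close> in the open ball of radius \<open>dist x0 y\<close>, but its sphere may
      carry further maximum points.\<close>
    ultimately obtain y where y: "y \<in> Z" "\<And>z. z \<in> Z \<Longrightarrow> dist x0 y \<le> dist x0 z"
      using distance_attains_inf[of Z x0] by blast
    have uy: "u y = u p" using y(1) by (simp add: Z_def)
    have yU: "y \<in> U" using y(1) sub \<rho>(2) by (auto simp: Z_def)
    define R where "R = dist x0 y / 2"
    have "x0 \<noteq> y" using neq uy by auto
    then have R: "R > 0" by (simp add: R_def)
    have less: "u z < u p" if "dist x0 z < 2 * R" for z
    proof -
      have "z \<in> cball x0 (dist x0 p)" using that y(2)[OF \<open>p \<in> Z\<close>] by (simp add: R_def)
      moreover have "z \<notin> Z" using y(2)[of z] that by (auto simp: R_def)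
      moreover have "z \<in> U" using calculation sub \<rho>(2) by auto
      ultimately show ?thesis using max[of z] by (auto simp: Z_def)
    qed
    \<comment> \<open>Centre of the ball of half the radius that touches the former one from inside
      at \<open>y\<close>. The two spheres meet in \<open>y\<close> alone, by the parallelogram law,
      so no other maximum point is left.\<close>
    define c where "c = (1/2) *\<^sub>R (x0 + y)"
    have yc: "norm (y - c) = R" and cx: "c - x0 = y - c"
    proof -
      have "y - c = (1/2) *\<^sub>R (y - x0)" by (simp add: c_def algebra_simps flip: scaleR_add_left)
      then show "norm (y - c) = R" by (simp add: R_def dist_norm norm_minus_commute)
      show "c - x0 = y - c" by (simp add: c_def algebra_simps flip: scaleR_add_left)
    qed
    have parallelogram: "(norm (v + w))\<^sup>2 + (norm (v - w))\<^sup>2 = 2 * (norm v)\<^sup>2 + 2 * (norm w)\<^sup>2"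
      for v w :: "real^'n"
      by (simp add: power2_norm_eq_inner inner_add_left inner_add_right inner_diff_left
          inner_diff_right inner_commute)
    have less': "u z < u p" if z: "norm (z - c) \<le> R" "z \<noteq> y" for z
    proof (rule less, rule ccontr)
      assume "\<not> dist x0 z < 2 * R"
      moreover have "z - x0 = (z - c) + (y - c)" using cx by (simp add: algebra_simps)
      ultimately have "norm ((z - c) + (y - c)) \<ge> 2 * R"
        by (metis dist_commute dist_norm not_less)
      then have "(norm ((z - c) + (y - c)))\<^sup>2 \<ge> (2 * R)\<^sup>2"
        using R by (intro power_mono) auto
      moreover have "(norm (z - c))\<^sup>2 \<le> R\<^sup>2" using z by (intro power_mono) auto
      moreover have "(norm ((z - c) + (y - c)))\<^sup>2 + (norm ((z - c) - (y - c)))\<^sup>2 =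
          2 * (norm (z - c))\<^sup>2 + 2 * (norm (y - c))\<^sup>2"
        by (rule parallelogram)
      moreover have "(2 * R)\<^sup>2 = 4 * R\<^sup>2" by (simp add: power_mult_distrib)
      ultimately have "(norm ((z - c) - (y - c)))\<^sup>2 \<le> 0" unfolding yc by linarith
      then show False using z by simp
    qed
    obtain r0 where r0: "r0 > 0" "cball y r0 \<subseteq> U" using U(1) yU open_contains_cball by metis
    \<comment> \<open>At most half of \<open>R\<close>, so that \<open>c\<close> lies outside
      \<open>?K\<close> and the quadratic form \<open>?q\<close> in \<open>x - c\<close> has a
      positive minimum \<open>m\<close> there.\<close>
    define r where "r = min r0 (R / 2)"
    have r: "r > 0" "r < R" "cball y r \<subseteq> U" using r0 R by (auto simp: r_def)
    let ?K = "cball y r"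
    have ne: "x \<noteq> c" if "x \<in> ?K" for x using that r yc by (auto simp: dist_norm)
    let ?q = "\<lambda>x. \<Sum>i\<in>UNIV. \<Sum>j\<in>UNIV. a x i j * (x - c) $ i * (x - c) $ j"
    let ?T = "\<lambda>x. (\<Sum>i\<in>UNIV. a x i i) - (x - c) \<bullet> b x"
    have cont: "continuous_on ?K ?q" "continuous_on ?K ?T"
      using continuous_on_subset[OF a_cont r(3)] continuous_on_subset[OF b_cont r(3)]
      by (auto intro!: continuous_intros)
    obtain x1 where x1: "x1 \<in> ?K" "\<And>x. x \<in> ?K \<Longrightarrow> ?q x1 \<le> ?q x"
      using continuous_attains_inf[OF compact_cball _ cont(1)] r(1) by fastforce
    define m where "m = ?q x1"
    have m: "m > 0" unfolding m_def using a_pos[of x1 "x1 - c"] ne[OF x1(1)] x1(1) r(3) by auto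
    obtain x2 where x2: "x2 \<in> ?K" "\<And>x. x \<in> ?K \<Longrightarrow> ?T x \<le> ?T x2"
      using continuous_attains_sup[OF compact_cball _ cont(2)] r(1) by fastforce
    \<comment> \<open>On \<open>?K\<close> the operator including the drift maps \<open>h\<close> to
      \<open>2 * \<alpha> * (2 * \<alpha> * ?q x - ?T x)\<close> times the exponential; this
      \<alpha> makes \<open>2 * \<alpha> * m\<close> exceed the maximum
      \<open>?T x2\<close>.\<close>
    define \<alpha> where "\<alpha> = (\<bar>?T x2\<bar> + 1) / m"
    have \<alpha>: "\<alpha> > 0" using m by (simp add: \<alpha>_def add_nonneg_pos)
    have \<alpha>m: "2 * \<alpha> * m = 2 * \<bar>?T x2\<bar> + 2" using m by (simp add: \<alpha>_def)
    \<comment> \<open>Makes \<open>h\<close> vanish on the sphere of radius \<open>R\<close> around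
      \<open>c\<close>, in particular at \<open>y\<close>, and negative outside it.\<close>
    define k where "k = exp (- \<alpha> * R\<^sup>2)"
    define h where "h = (\<lambda>x. exp (- \<alpha> * ((x - c) \<bullet> (x - c))) - k)"
    have h_der: "(h has_derivative (\<lambda>v. - 2 * \<alpha> * ((x - c) \<bullet> v) * (h x + k))) (at x)"
      and Dh: "D h x v = - 2 * \<alpha> * ((x - c) \<bullet> v) * (h x + k)"
      and Dh_der: "((\<lambda>x. D h x v) has_derivative (\<lambda>w.
        (4 * \<alpha>\<^sup>2 * ((x - c) \<bullet> v) * ((x - c) \<bullet> w) - 2 * \<alpha> * (w \<bullet> v)) * (h x + k))) (at x)" for x v
      unfolding h_def by (rule gaussian_derivatives)+
    have DDh: "D (\<lambda>x. D h x v) x w =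
        (4 * \<alpha>\<^sup>2 * ((x - c) \<bullet> v) * ((x - c) \<bullet> w) - 2 * \<alpha> * (w \<bullet> v)) * (h x + k)" for x v w
      by (simp add: D_eq[OF Dh_der])
    have hk: "h x + k > 0" for x by (simp add: h_def)
    have hy: "h y = 0" by (simp add: h_def k_def yc flip: power2_norm_eq_inner)
    have h_sub: "(\<Sum>i\<in>UNIV. \<Sum>j\<in>UNIV. a x i j * D (\<lambda>y. D h y (axis j 1)) x (axis i 1)) > D h x (b x)"
      if x: "x \<in> ?K" for x
    proof -
      have "(\<Sum>i\<in>UNIV. \<Sum>j\<in>UNIV. a x i j * D (\<lambda>y. D h y (axis j 1)) x (axis i 1)) =
        (\<Sum>i\<in>UNIV. \<Sum>j\<in>UNIV. (4 * \<alpha>\<^sup>2 * (a x i j * (x - c) $ i * (x - c) $ j)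
           - 2 * \<alpha> * (if j = i then a x i j else 0)) * (h x + k))"
        unfolding DDh by (intro sum.cong refl)
          (simp add: inner_axis axis_nth algebra_simps)
      also have "\<dots> = (4 * \<alpha>\<^sup>2 * ?q x - 2 * \<alpha> * (\<Sum>i\<in>UNIV. a x i i)) * (h x + k)"
        by (simp only: sum_distrib_right[symmetric] sum_subtractf sum_distrib_left[symmetric]) simp
      finally have eq: "(\<Sum>i\<in>UNIV. \<Sum>j\<in>UNIV. a x i j * D (\<lambda>y. D h y (axis j 1)) x (axis i 1)) - D h x (b x)
          = 2 * \<alpha> * (2 * \<alpha> * ?q x - ?T x) * (h x + k)"
        by (simp add: Dh power2_eq_square algebra_simps)
      have "2 * \<alpha> * ?q x \<ge> 2 * \<alpha> * m"
        using x1(2)[OF x] \<alpha> unfolding m_def by (intro mult_left_mono) auto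
      moreover have "X - t > 0" if "A \<le> X" "A = 2 * \<bar>t'\<bar> + 2" "t \<le> t'" for A X t t' :: real
        using that by linarith
      ultimately have "2 * \<alpha> * ?q x - ?T x > 0" using \<alpha>m x2(2)[OF x] by blast
      then have "2 * \<alpha> * (2 * \<alpha> * ?q x - ?T x) * (h x + k) > 0"
        using \<alpha> hk[of x] by (intro mult_pos_pos) auto
      then show ?thesis unfolding eq[symmetric] by simp
    qed
    \<comment> \<open>The part of \<open>sphere y r\<close> inside \<open>cball c R\<close> is
      compact and misses \<open>y\<close>, so there \<open>u\<close> stays below \<open>u p\<close>
      by a fixed gap.\<close>
    obtain \<delta> where \<delta>: "\<delta> > 0" "\<And>x. x \<in> sphere y r \<inter> cball c R \<Longrightarrow> u x \<le> u p - \<delta>"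
    proof (cases "sphere y r \<inter> cball c R = {}")
      case True
      then show ?thesis using that[of 1] by auto
    next
      case False
      moreover have "sphere y r \<inter> cball c R \<subseteq> U" using r(3) by auto
      ultimately obtain s where s: "s \<in> sphere y r \<inter> cball c R"
          "\<And>x. x \<in> sphere y r \<inter> cball c R \<Longrightarrow> u x \<le> u s"
        using continuous_attains_sup[of "sphere y r \<inter> cball c R" u] continuous_on_subset[OF cu]
        by (metis compact_Int compact_cball compact_sphere)
      have "u s < u p" using s(1) r(1) by (intro less') (auto simp: dist_norm norm_minus_commute)
      then show ?thesis using that[of "u p - u s"] s(2) by auto
    qed
    \<comment> \<open>As \<open>h x \<le> 1\<close>, adding \<epsilon> times \<open>h\<close> cannot
      use up the gap \<delta>; on the rest of the sphere \<open>h\<close> is negative.\<close>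
    define \<epsilon> where "\<epsilon> = \<delta> / 2"
    have \<epsilon>: "\<epsilon> > 0" "\<epsilon> < \<delta>" using \<delta>(1) by (auto simp: \<epsilon>_def)
    define w where "w x = u x + \<epsilon> *\<^sub>R h x" for x
    have wy: "w y = u p" using hy uy by (simp add: w_def)
    have w_sphere: "w x < u p" if x: "x \<in> sphere y r" for x
    proof (cases "x \<in> cball c R")
      case True
      have "h x \<le> 1" using \<alpha> by (simp add: h_def k_def)
        (smt (verit) exp_gt_zero exp_le_one_iff inner_ge_zero mult_nonneg_nonneg)
      then have "\<epsilon> * h x \<le> \<epsilon>" using \<epsilon> by simp
      moreover have "u x \<le> u p - \<delta>" using \<delta>(2)[of x] True x by simp
      ultimately show ?thesis unfolding w_def real_scaleR_def using \<epsilon> by linarith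
    next
      case False
      then have "R\<^sup>2 < (norm (x - c))\<^sup>2"
        using R by (intro power_strict_mono) (auto simp: dist_norm norm_minus_commute)
      then have "h x < 0" using \<alpha> by (simp add: h_def k_def power2_norm_eq_inner)
      then have "\<epsilon> * h x < 0" using \<epsilon> by (simp add: mult_pos_neg)
      then show ?thesis using max[of x] x r(3) by (auto simp: w_def)
    qed
    have "continuous_on ?K h"
      unfolding h_def by (intro continuous_intros)
    then have "continuous_on ?K w"
      unfolding w_def using continuous_on_subset[OF cu r(3)] by (intro continuous_intros)
    then obtain x where x: "x \<in> ?K" "\<And>z. z \<in> ?K \<Longrightarrow> w z \<le> w x"
      using continuous_attains_sup[of ?K w] r(1) by fastforce
    have "w x \<ge> u p" using x(2)[of y] r(1) wy by simp
    then have xb: "x \<in> ball y r" using w_sphere[of x] x(1) by (force simp: less_le)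
    then have xU: "x \<in> U" using r(3) by auto
    have u_der: "(u has_derivative D u z) (at z)" "((\<lambda>y. D u y v) has_derivative D (\<lambda>y. D u y v) z) (at z)"
      if "z \<in> U" for z v
      using smooth_on_differentiable[OF u that] smooth_on_differentiable[OF smooth_on_D[OF u] that]
      by (auto intro: D_has_derivative)
    have w_der: "(w has_derivative (\<lambda>v. D u z v + \<epsilon> *\<^sub>R D h z v)) (at z)" if "z \<in> U" for z
      unfolding w_def Dh by (intro has_derivative_add has_derivative_scaleR_right u_der that h_der)
    have Dw: "D w z v = D u z v + \<epsilon> *\<^sub>R D h z v" if "z \<in> U" for z v
      by (simp add: D_eq[OF w_der[OF that]])
    have "((\<lambda>y. D u y v + \<epsilon> *\<^sub>R D h y v) has_derivative
        (\<lambda>s. D (\<lambda>y. D u y v) x s + \<epsilon> *\<^sub>R D (\<lambda>y. D h y v) x s)) (at x)" for v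
      unfolding DDh by (intro has_derivative_add has_derivative_scaleR_right u_der xU Dh_der)
    then have Dw_der: "((\<lambda>y. D w y v) has_derivative
        (\<lambda>s. D (\<lambda>y. D u y v) x s + \<epsilon> *\<^sub>R D (\<lambda>y. D h y v) x s)) (at x)" for v
      by (rule has_derivative_transform_within_open[OF _ U(1) xU]) (simp add: Dw)
    have le: "(\<Sum>i\<in>UNIV. \<Sum>j\<in>UNIV. a x i j * D (\<lambda>y. D w y (axis j 1)) x (axis i 1)) \<le> 0"
    proof (rule elliptic_at_max[OF open_ball xb])
      show "w differentiable (at z)" if "z \<in> ball y r" for z
        using that r(3) by (intro differentiableI[OF w_der]) auto
      show "(\<lambda>y. D w y v) differentiable (at x)" for v
        using Dw_der by (auto simp: differentiable_def)
      show "w z \<le> w x" if "z \<in> ball y r" for z using that x(2)[of z] by simp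
    qed (fact a_sym[OF xU] a_pos[OF xU])+
    have sum: "(\<Sum>i\<in>UNIV. \<Sum>j\<in>UNIV. a x i j * D (\<lambda>y. D w y (axis j 1)) x (axis i 1)) =
        D u x (b x) + \<epsilon> * (\<Sum>i\<in>UNIV. \<Sum>j\<in>UNIV. a x i j * D (\<lambda>y. D h y (axis j 1)) x (axis i 1))"
      unfolding eq[OF xU, symmetric]
      by (simp add: D_eq[OF Dw_der] distrib_left sum.distrib sum_distrib_left mult_ac)
    \<comment> \<open>\<open>D w x = 0\<close> at the interior maximum, so the drift terms of
      \<open>u\<close> and \<epsilon> times \<open>h\<close> cancel, and \<open>le\<close>
      contradicts \<open>h_sub\<close>.\<close>
    have Du: "D u x (b x) = - \<epsilon> * D h x (b x)"
    proof -
      have "D w x = (\<lambda>v. 0)"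
      proof (rule differential_zero_maxmin[OF xb open_ball])
        show "(w has_derivative D w x) (at x)"
          by (rule D_has_derivative[OF differentiableI[OF w_der[OF xU]]])
        show "(\<forall>z\<in>ball y r. w z \<le> w x) \<or> (\<forall>z\<in>ball y r. w x \<le> w z)"
          using x(2) by (meson ball_subset_cball subsetD)
      qed
      then have "D u x (b x) + \<epsilon> *\<^sub>R D h x (b x) = 0" unfolding Dw[OF xU, symmetric] by simp
      then show ?thesis by simp
    qed
    have "\<epsilon> * (\<Sum>i\<in>UNIV. \<Sum>j\<in>UNIV. a x i j * D (\<lambda>y. D h y (axis j 1)) x (axis i 1)) \<le> \<epsilon> * D h x (b x)"
      using le unfolding sum Du by linarith
    then show False using mult_strict_left_mono[OF h_sub[OF x(1)] \<epsilon>(1)] by linarith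
  qed
  then show ?thesis using \<rho>(1) by (metis half_gt_zero)
qed

section \<open>The equation of a self-similar Lagrangian immersion\<close>

locale local_immersion = local_metric G V for G :: "'e::euclidean_space metric" and V +
  fixes \<Phi> :: "real^'n \<Rightarrow> 'e" and W :: "(real^'n) set"
  assumes open_W: "open W"
    and smooth_\<Phi>: "smooth_on W \<Phi>"
    and \<Phi>_V: "x \<in> W \<Longrightarrow> \<Phi> x \<in> V"
    and inj_D\<Phi>: "x \<in> W \<Longrightarrow> inj (D \<Phi> x)"
begin

abbreviation induced :: "real^'n \<Rightarrow> real^'n \<Rightarrow> real^'n \<Rightarrow> real" where
  "induced x v w \<equiv> G (\<Phi> x) (D \<Phi> x v) (D \<Phi> x w)"

abbreviation inverse_gram :: "real^'n \<Rightarrow> real^'n^'n" where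
  "inverse_gram x \<equiv> matrix_inv (induced_gram G \<Phi> x)"

definition hess\<Phi> :: "real^'n \<Rightarrow> real^'n \<Rightarrow> real^'n \<Rightarrow> 'e" where
  "hess\<Phi> x u v = D (\<lambda>y. D \<Phi> y v) x u + \<Gamma> (\<Phi> x) (D \<Phi> x u) (D \<Phi> x v)"

text \<open>Unlike the tension field of a map, this trace omits the Christoffel symbols of the
  induced metric, just as the coordinate Hessian of \<theta> does. It differs from the mean
  curvature by a tangential vector.\<close>

definition tension :: "real^'n \<Rightarrow> 'e" where
  "tension x = (\<Sum>i\<in>UNIV. \<Sum>j\<in>UNIV. inverse_gram x $ i $ j *\<^sub>R hess\<Phi> x (axis i 1) (axis j 1))"

lemma \<Phi>_differentiable: "x \<in> W \<Longrightarrow> \<Phi> differentiable (at x)"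
  using smooth_\<Phi> by (rule smooth_on_differentiable)

lemma D\<Phi>_differentiable: "x \<in> W \<Longrightarrow> (\<lambda>y. D \<Phi> y v) differentiable (at x)"
  using smooth_on_D[OF smooth_\<Phi>] by (rule smooth_on_differentiable)

lemma linear_D\<Phi>: "x \<in> W \<Longrightarrow> linear (D \<Phi> x)"
  using \<Phi>_differentiable by (rule linear_frechet_derivative)

lemma compose_differentiable:
  "x \<in> W \<Longrightarrow> h differentiable (at (\<Phi> x)) \<Longrightarrow> (\<lambda>y. h (\<Phi> y)) differentiable (at x)"
  using differentiable_chain_at[OF \<Phi>_differentiable] by (simp add: o_def)

lemma D_compose:
  assumes "x \<in> W" "h differentiable (at (\<Phi> x))"
  shows "D (\<lambda>y. h (\<Phi> y)) x u = D h (\<Phi> x) (D \<Phi> x u)"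
proof -
  have "D (h \<circ> \<Phi>) x = D h (\<Phi> x) \<circ> D \<Phi> x"
    by (intro frechet_derivative_compose \<Phi>_differentiable assms)
  then show ?thesis by (simp add: o_def)
qed

lemma G_compose_differentiable:
  assumes x: "x \<in> W" and p: "p differentiable (at x)" and q: "q differentiable (at x)"
  shows "(\<lambda>y. G (\<Phi> y) (p y) (q y)) differentiable (at x)"
  by (rule differentiableI, rule bilinear_family_has_derivative[OF open_W x metric_bilinear
        compose_differentiable[OF x G_differentiable] D_has_derivative[OF p] D_has_derivative[OF q]])
    (auto simp: \<Phi>_V x)

lemma bilinear_induced: "x \<in> W \<Longrightarrow> bilinear (induced x)"
  using linear_compose[OF linear_D\<Phi> bilinear_linear(1)[OF metric_bilinear[OF \<Phi>_V]]]
    linear_compose[OF linear_D\<Phi> bilinear_linear(2)[OF metric_bilinear[OF \<Phi>_V]]]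
  by (simp add: bilinear_def o_def)

lemma induced_sym: "x \<in> W \<Longrightarrow> induced x v w = induced x w v"
  by (simp add: metric_sym \<Phi>_V)

lemma D\<Phi>_eq_0: "x \<in> W \<Longrightarrow> D \<Phi> x v = 0 \<Longrightarrow> v = 0"
  using inj_D\<Phi> linear_injective_0[OF linear_D\<Phi>] by blast

lemma induced_pos: "x \<in> W \<Longrightarrow> v \<noteq> 0 \<Longrightarrow> induced x v v > 0"
  using metric_pos[OF \<Phi>_V] D\<Phi>_eq_0 by blast

lemma induced_eq_0: "x \<in> W \<Longrightarrow> induced x v v = 0 \<Longrightarrow> v = 0"
  using induced_pos by fastforce

lemma induced_differentiable: "x \<in> W \<Longrightarrow> (\<lambda>y. induced y v w) differentiable (at x)"
  by (intro G_compose_differentiable D\<Phi>_differentiable)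

lemma induced_solution_differentiable:
  assumes x: "x \<in> W" and "\<And>x w. x \<in> W \<Longrightarrow> induced x (z x) w = h x w"
    and "\<And>w. (\<lambda>y. h y w) differentiable (at x)"
  shows "z differentiable (at x)"
  using open_W x bilinear_induced induced_pos[OF x] induced_differentiable[OF x] assms(3) assms(2)
  by (rule solution_differentiable)

lemma continuous_on_W: "(\<And>x. x \<in> W \<Longrightarrow> z differentiable (at x)) \<Longrightarrow> continuous_on W z"
  by (intro differentiable_imp_continuous_on) (auto simp: differentiable_on_def differentiable_at_withinI)

text \<open>Provides the vector fields that make up the drift of the elliptic equation; the maximum
  principle asks for their continuity.\<close>

lemma induced_riesz:
  assumes lin: "\<And>x. x \<in> W \<Longrightarrow> linear (h x)"
    and diff: "\<And>x w. x \<in> W \<Longrightarrow> (\<lambda>y. h y w) differentiable (at x)"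
  shows "\<exists>z. continuous_on W z \<and> (\<forall>x\<in>W. \<forall>w. induced x (z x) w = h x w)"
proof -
  define z where "z x = (THE z. \<forall>w. induced x z w = h x w)" for x
  have z: "induced x (z x) w = h x w" if "x \<in> W" for x w
    using theI'[OF riesz_unique[OF bilinear_induced[OF that] induced_pos[OF that] lin[OF that]]]
    unfolding z_def by blast
  have "continuous_on W z"
    by (intro continuous_on_W induced_solution_differentiable[where h = h] z diff)
  with z show ?thesis by blast
qed

lemma induced_gram_inner:
  assumes "x \<in> W"
  shows "v \<bullet> (induced_gram G \<Phi> x *v w) = induced x v w"
proof -
  have "induced x v w = (\<Sum>i\<in>UNIV. \<Sum>j\<in>UNIV. v $ i * w $ j * induced x (axis i 1) (axis j 1))"
    using linear_expand_axis[OF bilinear_linear(2)[OF bilinear_induced[OF assms], of w], of v]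
    by (subst (asm) linear_expand_axis[OF bilinear_linear(1)[OF bilinear_induced[OF assms]], of _ w])
      (simp add: sum_distrib_left mult.assoc)
  then show ?thesis
    by (simp add: inner_vec_def matrix_vector_mult_def induced_gram_def sum_distrib_left mult_ac)
qed

lemma induced_gram_inverse:
  assumes x: "x \<in> W"
  shows "induced_gram G \<Phi> x ** inverse_gram x = mat 1"
proof -
  have "invertible (induced_gram G \<Phi> x)"
    unfolding invertible_left_inverse matrix_left_invertible_ker
    using induced_gram_inner[OF x] induced_eq_0[OF x] by (metis inner_zero_right)
  then show ?thesis by (simp add: invertible_def matrix_inv_def) (metis (mono_tags, lifting) someI_ex)
qed

text \<open>The inverse Gram matrix as the operator raising indices: symmetry, positivity and
  differentiability of its entries are all read off from this identity, without
  determinants.\<close>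

lemma induced_inverse_gram:
  assumes "x \<in> W"
  shows "induced x v (inverse_gram x *v w) = v \<bullet> w"
  unfolding induced_gram_inner[OF assms, symmetric]
  by (simp add: matrix_vector_mul_assoc induced_gram_inverse[OF assms])

lemma matrix_entry_inner: "M $ i $ j = axis i 1 \<bullet> (M *v axis j (1::real))"
  by (simp add: inner_axis' matrix_vector_mul_component inner_axis)

lemma inverse_gram_sym:
  assumes x: "x \<in> W"
  shows "inverse_gram x $ i $ j = inverse_gram x $ j $ i"
proof -
  have entry: "inverse_gram x $ j $ i = induced x (inverse_gram x *v axis i 1) (inverse_gram x *v axis j 1)" for i j
    unfolding induced_inverse_gram[OF x] by (simp add: matrix_entry_inner[of _ j] inner_commute)
  show ?thesis unfolding entry by (rule induced_sym[OF x])
qed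

lemma inverse_gram_pos:
  assumes x: "x \<in> W" and "\<xi> \<noteq> 0"
  shows "0 < (\<Sum>i\<in>UNIV. \<Sum>j\<in>UNIV. inverse_gram x $ i $ j * \<xi> $ i * \<xi> $ j)"
proof -
  define \<eta> where "\<eta> = inverse_gram x *v \<xi>"
  have "\<eta> \<noteq> 0"
    using induced_inverse_gram[OF x, of \<xi> \<xi>] \<open>\<xi> \<noteq> 0\<close> bilinear_rzero[OF bilinear_induced[OF x]]
    unfolding \<eta>_def by (metis inner_eq_zero_iff)
  then have "0 < induced x \<eta> \<eta>" by (rule induced_pos[OF x])
  also have "\<dots> = \<eta> \<bullet> \<xi>" unfolding \<eta>_def by (rule induced_inverse_gram[OF x])
  also have "\<dots> = (\<Sum>i\<in>UNIV. \<Sum>j\<in>UNIV. inverse_gram x $ i $ j * \<xi> $ i * \<xi> $ j)"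
    by (simp add: \<eta>_def inner_vec_def matrix_vector_mult_def sum_distrib_right sum_distrib_left mult_ac)
  finally show ?thesis .
qed

text \<open>Column \<open>j\<close> solves a linear system for the induced metric whose right-hand
  side does not depend on the point.\<close>

lemma inverse_gram_differentiable:
  assumes x: "x \<in> W"
  shows "(\<lambda>x. inverse_gram x $ i $ j) differentiable (at x)"
proof -
  have "(\<lambda>x. inverse_gram x *v axis j 1) differentiable (at x)"
    by (rule induced_solution_differentiable[OF x, where h = "\<lambda>x w. w \<bullet> axis j 1"])
      (metis induced_inverse_gram induced_sym, simp)
  then have "(\<lambda>x. axis i 1 \<bullet> (inverse_gram x *v axis j 1)) differentiable (at x)"
    by (intro differentiable_inner) auto
  then show ?thesis by (simp flip: matrix_entry_inner)
qed

lemma hess\<Phi>_differentiable: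
  assumes x: "x \<in> W"
  shows "(\<lambda>y. hess\<Phi> y u v) differentiable (at x)"
proof -
  have "(\<lambda>y. \<Gamma> (\<Phi> y) (D \<Phi> y u) (D \<Phi> y v)) differentiable (at x)"
    by (rule differentiableI, rule bilinear_family_has_derivative[OF open_W x bilinear_christoffel[OF \<Phi>_V]
          compose_differentiable[OF x christoffel_differentiable[OF \<Phi>_V[OF x]]]
          D_has_derivative[OF D\<Phi>_differentiable[OF x]] D_has_derivative[OF D\<Phi>_differentiable[OF x]]])
  then show ?thesis unfolding hess\<Phi>_def
    by (intro differentiable_add smooth_on_differentiable[OF smooth_on_D[OF smooth_on_D[OF smooth_\<Phi>]] x])
qed

lemma tension_differentiable: "x \<in> W \<Longrightarrow> tension differentiable (at x)"
  unfolding tension_def[abs_def]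
  by (intro differentiable_sum ballI differentiable_scaleR inverse_gram_differentiable
      hess\<Phi>_differentiable) auto

text \<open>The tangential part is a Riesz representative for the induced metric; the difference of
  two candidates would be tangential and normal at once.\<close>

lemma normal_part:
  assumes x: "x \<in> W"
  shows "(\<exists>t. z - normal_part G \<Phi> x z = D \<Phi> x t) \<and> (\<forall>s. G (\<Phi> x) (normal_part G \<Phi> x z) (D \<Phi> x s) = 0)"
  unfolding normal_part_def
proof (rule theI')
  note [simp] = G_simps[OF \<Phi>_V[OF x]]
  have "linear (\<lambda>s. G (\<Phi> x) z (D \<Phi> x s))"
    using linear_compose[OF linear_D\<Phi>[OF x] bilinear_linear(1)[OF metric_bilinear[OF \<Phi>_V[OF x]]]] by (simp add: o_def)
  from riesz_unique[OF bilinear_induced[OF x] induced_pos[OF x] this]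
  obtain t where t: "\<And>s. induced x t s = G (\<Phi> x) z (D \<Phi> x s)" by metis
  show "\<exists>!y. (\<exists>t. z - y = D \<Phi> x t) \<and> (\<forall>s. G (\<Phi> x) y (D \<Phi> x s) = 0)"
  proof (rule ex1I[of _ "z - D \<Phi> x t"])
    show "(\<exists>t'. z - (z - D \<Phi> x t) = D \<Phi> x t') \<and> (\<forall>s. G (\<Phi> x) (z - D \<Phi> x t) (D \<Phi> x s) = 0)"
      using t by auto
    fix y assume y: "(\<exists>t. z - y = D \<Phi> x t) \<and> (\<forall>s. G (\<Phi> x) y (D \<Phi> x s) = 0)"
    then obtain t' where t': "z - y = D \<Phi> x t'" by blast
    have "induced x (t' - t) (t' - t) = 0"
    proof -
      have "D \<Phi> x (t' - t) = (z - D \<Phi> x t) - y"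
        by (simp add: linear_diff[OF linear_D\<Phi>[OF x]] t'[symmetric])
      moreover have "G (\<Phi> x) ((z - D \<Phi> x t) - y) (D \<Phi> x s) = 0" for s
        using y t[of s] by simp
      ultimately show ?thesis by metis
    qed
    then have "t' = t" using induced_eq_0[OF x, of "t' - t"] by simp
    then show "y = z - D \<Phi> x t" using t' by (simp add: algebra_simps)
  qed
qed

lemma mean_curvature_normal:
  assumes x: "x \<in> W"
  shows "G (\<Phi> x) (mean_curvature G \<Phi> x) (D \<Phi> x s) = 0"
proof -
  have lin: "linear (\<lambda>z. G (\<Phi> x) z (D \<Phi> x s))"
    by (rule bilinear_linear(2)[OF metric_bilinear[OF \<Phi>_V[OF x]]])
  show ?thesis
    unfolding mean_curvature_def second_fundamental_form_def
    by (simp add: linear_sum[OF lin] linear_cmul[OF lin] normal_part[OF x])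
qed

lemma mean_curvature_tension:
  assumes x: "x \<in> W"
  shows "\<exists>t. tension x - mean_curvature G \<Phi> x = D \<Phi> x t"
proof -
  have "\<exists>t. hess\<Phi> x (axis i 1) (axis j 1) - second_fundamental_form G \<Phi> x (axis i 1) (axis j 1) = D \<Phi> x t"
    for i j
    unfolding second_fundamental_form_def hess\<Phi>_def by (rule conjunct1[OF normal_part[OF x]])
  from someI_ex[OF this]
  obtain t where t: "\<And>i j. hess\<Phi> x (axis i 1) (axis j 1) - second_fundamental_form G \<Phi> x (axis i 1) (axis j 1)
      = D \<Phi> x (t i j)"
    by (rule that)
  have "D \<Phi> x (\<Sum>i\<in>UNIV. \<Sum>j\<in>UNIV. inverse_gram x $ i $ j *\<^sub>R t i j) =
      (\<Sum>i\<in>UNIV. \<Sum>j\<in>UNIV. inverse_gram x $ i $ j *\<^sub>R D \<Phi> x (t i j))"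
    by (simp only: linear_sum[OF linear_D\<Phi>[OF x]] linear_cmul[OF linear_D\<Phi>[OF x]])
  also have "\<dots> = tension x - mean_curvature G \<Phi> x"
    unfolding tension_def mean_curvature_def t[symmetric] scaleR_diff_right sum_subtractf ..
  finally show ?thesis by (intro exI) (rule sym)
qed

end

section \<open>Lagrangian tangent spaces\<close>

locale local_lagrangian = local_kahler G V + local_immersion G V \<Phi> W
  for G :: "(complex^'n) metric" and V and \<Phi> :: "real^'n \<Rightarrow> complex^'n" and W +
  assumes lagrangian: "x \<in> W \<Longrightarrow> kahler_form G (\<Phi> x) (D \<Phi> x u) (D \<Phi> x v) = 0"
begin

lemma lagrangian_J: "x \<in> W \<Longrightarrow> G (\<Phi> x) (D \<Phi> x u) (J (D \<Phi> x v)) = 0"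
  using lagrangian[of x u v] G_J_left[OF \<Phi>_V, of x "D \<Phi> x u" "D \<Phi> x v"] by (simp add: kahler_form_def)

text \<open>A dimension count: tangent vectors are orthogonal to \<open>J\<close> of tangent
  vectors, so \<open>T\<close> is injective between spaces of equal real dimension, hence onto. The
  component of \<open>J z\<close> in the \<open>J\<close>-part vanishes because \<open>z\<close> is
  normal.\<close>

lemma J_normal_tangential:
  assumes x: "x \<in> W" and normal: "\<And>v. G (\<Phi> x) z (D \<Phi> x v) = 0"
  shows "\<exists>s. J z = D \<Phi> x s"
proof -
  note [simp] = G_simps[OF \<Phi>_V[OF x]] hermitian[OF \<Phi>_V[OF x]] lagrangian_J[OF x]
  have lag': "G (\<Phi> x) (J (D \<Phi> x u)) (D \<Phi> x v) = 0" for u v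
    using lagrangian[OF x] by (simp add: kahler_form_def)
  define T where "T = (\<lambda>(u, v). D \<Phi> x u + J (D \<Phi> x v))"
  have linT: "linear T"
    by (intro linearI) (auto simp: T_def linear_add[OF linear_D\<Phi>[OF x]] linear_cmul[OF linear_D\<Phi>[OF x]]
        linear_add[OF linear_J] linear_cmul[OF linear_J] algebra_simps)
  have "inj T"
  proof (rule linear_injective_0[OF linT, THEN iffD2], intro allI impI)
    fix p assume T0: "T p = 0"
    obtain u v where p: "p = (u, v)" by fastforce
    have "induced x u u = G (\<Phi> x) (T p) (D \<Phi> x u)" by (simp add: p T_def lag')
    then have "u = 0" using T0 induced_eq_0[OF x] bilinear_lzero[OF metric_bilinear[OF \<Phi>_V[OF x]]] by simp
    have "induced x v v = G (\<Phi> x) (T p) (J (D \<Phi> x v))" by (simp add: p T_def)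
    then have "v = 0" using T0 induced_eq_0[OF x] bilinear_lzero[OF metric_bilinear[OF \<Phi>_V[OF x]]] by simp
    show "p = 0" using p \<open>u = 0\<close> \<open>v = 0\<close> by (simp add: zero_prod_def)
  qed
  then have "surj T"
    by (rule linear_injective_imp_surjective[OF linT]) simp
  then obtain u v where uv: "J z = D \<Phi> x u + J (D \<Phi> x v)"
    unfolding T_def by (metis (mono_tags, lifting) case_prod_beta surj_def)
  have "0 = G (\<Phi> x) (J z) (J (D \<Phi> x v))" using normal by simp
  also have "\<dots> = induced x v v" unfolding uv by simp
  finally have "v = 0" using induced_eq_0[OF x] by simp
  then have "J z = D \<Phi> x u"
    using uv by (simp add: linear_0[OF linear_D\<Phi>[OF x]] linear_0[OF linear_J])
  then show ?thesis ..
qed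

text \<open>With H the mean curvature and \<open>s\<close> such that \<open>D \<Phi> x s\<close> is
  JH, the form evaluated on \<open>s\<close> is the squared length of JH.\<close>

lemma mean_curvature_eq_0:
  assumes x: "x \<in> W" and form0: "\<And>v. mean_curvature_form G \<Phi> x v = 0"
  shows "mean_curvature G \<Phi> x = 0"
proof -
  obtain s where s: "J (mean_curvature G \<Phi> x) = D \<Phi> x s"
    using J_normal_tangential[OF x mean_curvature_normal[OF x]] by blast
  have "induced x s s = 0"
    using form0[of s] by (simp add: mean_curvature_form_def kahler_form_def s)
  then have "s = 0" by (rule induced_eq_0[OF x])
  then have "J (J (mean_curvature G \<Phi> x)) = 0"
    by (simp add: s linear_0[OF linear_D\<Phi>[OF x]] linear_0[OF linear_J])
  then show ?thesis by (simp add: J_J)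
qed

end

section \<open>The elliptic equation for the potential of the mean curvature form\<close>

locale local_self_similar = local_lagrangian G V \<Phi> W
  for G :: "(complex^'n) metric" and V and \<Phi> :: "real^'n \<Rightarrow> complex^'n" and W +
  fixes \<phi> :: "complex^'n \<Rightarrow> real" and \<kappa> :: real and \<theta> :: "real^'n \<Rightarrow> real"
  assumes smooth_\<phi>: "smooth_on V \<phi>"
    and soliton: "z \<in> V \<Longrightarrow> ricci G z v w + hessian G \<phi> z v w - 1/2 * G z v w = 0"
    and self_similar: "x \<in> W \<Longrightarrow>
      mean_curvature G \<Phi> x = \<kappa> *\<^sub>R normal_part G \<Phi> x (gradient G \<phi> (\<Phi> x))"
    and exact: "x \<in> W \<Longrightarrow> mean_curvature_form G \<Phi> x s = D \<theta> x s"
    and smooth_\<theta>: "smooth_on W \<theta>"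
begin

lemma \<phi>_differentiable: "z \<in> V \<Longrightarrow> \<phi> differentiable (at z)"
  using smooth_\<phi> by (rule smooth_on_differentiable)

lemma D\<phi>_differentiable: "z \<in> V \<Longrightarrow> (\<lambda>y. D \<phi> y w) differentiable (at z)"
  using smooth_on_D[OF smooth_\<phi>] by (rule smooth_on_differentiable)

lemma linear_D\<phi>: "z \<in> V \<Longrightarrow> linear (D \<phi> z)"
  using \<phi>_differentiable by (rule linear_frechet_derivative)

text \<open>\<open>J (D \<Phi> x v)\<close> is normal, so it does not see the tangential vector that
  \<open>normal_part\<close> removes from the gradient. With \<open>normal_part\<close> and
  \<open>gradient\<close> gone, the identity can be differentiated.\<close>

lemma D\<theta>_eq:
  assumes x: "x \<in> W"
  shows "D \<theta> x v = - \<kappa> * D \<phi> (\<Phi> x) (J (D \<Phi> x v))"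
proof -
  let ?z = "gradient G \<phi> (\<Phi> x)"
  note [simp] = G_simps[OF \<Phi>_V[OF x]]
  obtain t where "?z - normal_part G \<Phi> x ?z = D \<Phi> x t" using normal_part[OF x] by blast
  then have n: "normal_part G \<Phi> x ?z = ?z - D \<Phi> x t" by (simp add: algebra_simps)
  have "D \<theta> x v = - G (\<Phi> x) (mean_curvature G \<Phi> x) (J (D \<Phi> x v))"
    by (simp add: exact[OF x, symmetric] mean_curvature_form_def kahler_form_def G_J_left[OF \<Phi>_V[OF x]])
  also have "\<dots> = - \<kappa> * G (\<Phi> x) ?z (J (D \<Phi> x v))"
    unfolding self_similar[OF x] n by (simp add: lagrangian_J[OF x])
  also have "\<dots> = - \<kappa> * D \<phi> (\<Phi> x) (J (D \<Phi> x v))"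
    by (simp add: gradient_eq[OF \<Phi>_V[OF x] \<phi>_differentiable[OF \<Phi>_V[OF x]]])
  finally show ?thesis .
qed

text \<open>The ambient Christoffel terms contained in \<open>hessian\<close> and in
  \<open>hess\<Phi>\<close> cancel each other, because \<open>christoffel_J\<close> lets
  \<open>J\<close> pass through them.\<close>

lemma DD\<theta>_eq:
  assumes x: "x \<in> W"
  shows "D (\<lambda>y. D \<theta> y v) x u = - \<kappa> * (hessian G \<phi> (\<Phi> x) (D \<Phi> x u) (J (D \<Phi> x v))
    + D \<phi> (\<Phi> x) (J (hess\<Phi> x u v)))"
proof -
  note blJ = linear_J[unfolded linear_conv_bounded_linear]
  have "((\<lambda>y. D \<phi> (\<Phi> y) (J (D \<Phi> y v))) has_derivative
     (\<lambda>u. D (\<lambda>y. D \<phi> (\<Phi> y) (J (D \<Phi> x v))) x u + D \<phi> (\<Phi> x) (J (D (\<lambda>y. D \<Phi> y v) x u)))) (at x)"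
    by (rule linear_family_has_derivative[OF open_W x linear_D\<phi>[OF \<Phi>_V]
        compose_differentiable[OF x D\<phi>_differentiable[OF \<Phi>_V[OF x]]]
        bounded_linear.has_derivative[OF blJ D_has_derivative[OF D\<Phi>_differentiable[OF x]]]])
  from has_derivative_scaleR_right[OF this, of "- \<kappa>"]
  have "D (\<lambda>y. - \<kappa> *\<^sub>R D \<phi> (\<Phi> y) (J (D \<Phi> y v))) x u = - \<kappa> *\<^sub>R
     (D (\<lambda>y. D \<phi> (\<Phi> y) (J (D \<Phi> x v))) x u + D \<phi> (\<Phi> x) (J (D (\<lambda>y. D \<Phi> y v) x u)))"
    by (simp only: D_eq)
  also have "D (\<lambda>y. D \<phi> (\<Phi> y) (J (D \<Phi> x v))) x u = D (\<lambda>z. D \<phi> z (J (D \<Phi> x v))) (\<Phi> x) (D \<Phi> x u)"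
    by (rule D_compose[OF x D\<phi>_differentiable[OF \<Phi>_V[OF x]]])
  also have "D (\<lambda>y. - \<kappa> *\<^sub>R D \<phi> (\<Phi> y) (J (D \<Phi> y v))) x = D (\<lambda>y. D \<theta> y v) x"
    using x by (intro D_cong[OF open_W]) (simp_all add: D\<theta>_eq)
  finally show ?thesis
    by (simp add: hessian_def hess\<Phi>_def christoffel_J[OF \<Phi>_V[OF x]] linear_add[OF linear_J]
        linear_add[OF linear_D\<phi>[OF \<Phi>_V[OF x]]])
qed

lemma \<theta>_elliptic_equation:
  obtains b where "continuous_on W b"
    and "\<And>x. x \<in> W \<Longrightarrow> (\<Sum>i\<in>UNIV. \<Sum>j\<in>UNIV.
      inverse_gram x $ i $ j * D (\<lambda>y. D \<theta> y (axis j 1)) x (axis i 1)) = D \<theta> x (b x)"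
proof -
  have "linear (\<lambda>s. G (\<Phi> x) (tension x) (D \<Phi> x s))" if "x \<in> W" for x
    using linear_compose[OF linear_D\<Phi> bilinear_linear(1)[OF metric_bilinear[OF \<Phi>_V]]] that by (simp add: o_def)
  from induced_riesz[OF this G_compose_differentiable[OF _ tension_differentiable D\<Phi>_differentiable]]
  \<comment> \<open>\<open>D \<Phi> x (t x)\<close> is the tangential part of
    \<open>tension x\<close>.\<close>
  obtain t where t: "continuous_on W t"
      "\<And>x s. x \<in> W \<Longrightarrow> induced x (t x) s = G (\<Phi> x) (tension x) (D \<Phi> x s)"
    by blast
  have "linear (\<lambda>s. D \<phi> (\<Phi> x) (D \<Phi> x s))" if "x \<in> W" for x
    using linear_compose[OF linear_D\<Phi> linear_D\<phi>[OF \<Phi>_V]] that by (simp add: o_def)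
  moreover have "(\<lambda>y. D \<phi> (\<Phi> y) (D \<Phi> y w)) differentiable (at x)" if x: "x \<in> W" for x w
    by (rule differentiableI, rule linear_family_has_derivative[OF open_W x linear_D\<phi>[OF \<Phi>_V]
        compose_differentiable[OF x D\<phi>_differentiable[OF \<Phi>_V[OF x]]] D_has_derivative[OF D\<Phi>_differentiable[OF x]]])
  \<comment> \<open>\<open>r x\<close> is the gradient, for the induced metric, of \<phi> composed
    with \<Phi>.\<close>
  ultimately obtain r where r: "continuous_on W r"
      "\<And>x s. x \<in> W \<Longrightarrow> induced x (r x) s = D \<phi> (\<Phi> x) (D \<Phi> x s)"
    using induced_riesz[of "\<lambda>x s. D \<phi> (\<Phi> x) (D \<Phi> x s)"] by blast
  show thesis
  proof (rule that)
    show "continuous_on W (\<lambda>x. t x - \<kappa> *\<^sub>R r x)"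
      by (intro continuous_intros t r)
    fix x assume x: "x \<in> W"
    let ?H = "mean_curvature G \<Phi> x" and ?A = "\<lambda>i j. inverse_gram x $ i $ j"
      and ?d = "D \<phi> (\<Phi> x)"
    let ?S = "\<lambda>q. \<Sum>i\<in>UNIV. \<Sum>j\<in>UNIV. ?A i j * q i j"
    note [simp] = G_simps[OF \<Phi>_V[OF x]]
    have lind: "linear ?d" by (rule linear_D\<phi>[OF \<Phi>_V[OF x]])
    have lin\<theta>: "linear (D \<theta> x)"
      using smooth_on_differentiable[OF smooth_\<theta> x] by (rule linear_frechet_derivative)
    have anti: "?S q = 0" if "\<And>i j. q i j = - q j i" for q :: "'n \<Rightarrow> 'n \<Rightarrow> real"
    proof -
      have "?S q = (\<Sum>j\<in>UNIV. \<Sum>i\<in>UNIV. ?A i j * q i j)" by (rule sum.swap)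
      also have "\<dots> = ?S (\<lambda>i j. - q i j)"
        by (intro sum.cong refl arg_cong2[where f = "(*)"] inverse_gram_sym[OF x] that)
      also have "\<dots> = - ?S q" by (simp add: sum_negf)
      finally show ?thesis by simp
    qed
    have hess0: "?S (\<lambda>i j. hessian G \<phi> (\<Phi> x) (D \<Phi> x (axis i 1)) (J (D \<Phi> x (axis j 1)))) = 0"
      by (intro anti soliton_hessian_anti[OF \<Phi>_V[OF x] smooth_\<phi> soliton[OF \<Phi>_V[OF x]]])
    have tens: "?S (\<lambda>i j. ?d (J (hess\<Phi> x (axis i 1) (axis j 1)))) = ?d (J (tension x))"
      unfolding tension_def
      by (simp add: linear_sum[OF lind] linear_sum[OF linear_J] linear_cmul[OF lind] linear_cmul[OF linear_J])
    obtain t' where t': "tension x - ?H = D \<Phi> x t'"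
      using mean_curvature_tension[OF x] by blast
    have "induced x t' s = induced x (t x) s" for s
      unfolding t'[symmetric] t(2)[OF x] by (simp add: mean_curvature_normal[OF x])
    then have "induced x (t' - t x) (t' - t x) = 0"
      by (simp add: bilinear_lsub[OF bilinear_induced[OF x]])
    then have "t' = t x" using induced_eq_0[OF x, of "t' - t x"] by simp
    then have tension: "tension x = ?H + D \<Phi> x (t x)" using t' by (simp add: algebra_simps)
    \<comment> \<open>By \<open>exact\<close>, \<open>s\<close> is the gradient of \<theta> for the
      induced metric. So \<open>?d (J ?H)\<close> is a product of two gradients and can be read as
      the derivative of \<theta> along \<open>r x\<close>.\<close>
    obtain s where s: "J ?H = D \<Phi> x s"
      using J_normal_tangential[OF x mean_curvature_normal[OF x]] by blast
    have "?d (J ?H) = induced x (r x) s" unfolding s by (rule r(2)[OF x, symmetric])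
    also have "\<dots> = G (\<Phi> x) (J ?H) (D \<Phi> x (r x))" unfolding s by (rule induced_sym[OF x])
    also have "\<dots> = D \<theta> x (r x)"
      unfolding exact[OF x, symmetric] mean_curvature_form_def kahler_form_def ..
    finally have JH: "?d (J ?H) = D \<theta> x (r x)" .
    have "?S (\<lambda>i j. D (\<lambda>y. D \<theta> y (axis j 1)) x (axis i 1)) =
        - \<kappa> * (?S (\<lambda>i j. hessian G \<phi> (\<Phi> x) (D \<Phi> x (axis i 1)) (J (D \<Phi> x (axis j 1))))
          + ?S (\<lambda>i j. ?d (J (hess\<Phi> x (axis i 1) (axis j 1)))))"
      unfolding DD\<theta>_eq[OF x] by (simp only: distrib_left sum.distrib sum_distrib_left mult.left_commute[of _ "- \<kappa>"])
    also have "\<dots> = - \<kappa> * (D \<theta> x (r x) + ?d (J (D \<Phi> x (t x))))"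
      unfolding hess0 tens tension linear_add[OF linear_J] linear_add[OF lind] JH by simp
    \<comment> \<open>The tangential remainder is absorbed by \<open>D\<theta>_eq\<close> read
      backwards: it equals \<open>D \<theta> x (t x)\<close>.\<close>
    also have "\<dots> = D \<theta> x (t x - \<kappa> *\<^sub>R r x)"
      unfolding linear_diff[OF lin\<theta>] linear_cmul[OF lin\<theta>] D\<theta>_eq[OF x, of "t x"]
      by (simp add: algebra_simps)
    finally show "?S (\<lambda>i j. D (\<lambda>y. D \<theta> y (axis j 1)) x (axis i 1)) = D \<theta> x (t x - \<kappa> *\<^sub>R r x)" .
  qed
qed

end

section \<open>Compact self-similar Lagrangian immersions\<close>

text \<open>Let \<open>\<theta>\<close> attain its maximum over the closed set \<open>- C\<close> of points near which it is not
  constant at \<open>p\<close>.  On a connected neighbourhood of \<open>p\<close> a value larger than \<open>\<theta> p\<close> would be taken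
  only in \<open>C\<close>, hence on an open and closed subset not containing \<open>p\<close>.\<close>

lemma locally_constant_if_strong_maximum_principle:
  fixes \<theta> :: "'l::topological_space \<Rightarrow> real"
  assumes compact: "compact (UNIV :: 'l set)" and cont: "continuous_on UNIV \<theta>"
    and smp: "\<And>p. \<exists>O'. open O' \<and> connected O' \<and> p \<in> O' \<and>
      ((\<forall>q\<in>O'. \<theta> q \<le> \<theta> p) \<longrightarrow> (\<exists>U. open U \<and> p \<in> U \<and> (\<forall>q\<in>U. \<theta> p = \<theta> q)))"
  shows "\<exists>U. open U \<and> p \<in> U \<and> (\<forall>q\<in>U. \<theta> p = \<theta> q)"
proof -
  define C where "C = {p. \<exists>U. open U \<and> p \<in> U \<and> (\<forall>q\<in>U. \<theta> p = \<theta> q)}"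
  have "\<exists>T. open T \<and> p \<in> T \<and> T \<subseteq> C" if p: "p \<in> C" for p
  proof -
    obtain U where U: "open U" "p \<in> U" "\<forall>q\<in>U. \<theta> p = \<theta> q"
      using p unfolding C_def by blast
    have "U \<subseteq> C"
    proof
      fix q assume "q \<in> U"
      then have "\<forall>r\<in>U. \<theta> q = \<theta> r" using U(3) by metis
      with U(1) \<open>q \<in> U\<close> show "q \<in> C" unfolding C_def by blast
    qed
    with U(1,2) show ?thesis by blast
  qed
  then have "open C" by (rule Topological_Spaces.openI)
  then have "compact (- C)"
    using compact_diff[OF compact] by (simp add: Compl_eq_Diff_UNIV)
  have "- C = {}"
  proof (rule ccontr)
    assume "- C \<noteq> {}"
    from continuous_attains_sup[OF \<open>compact (- C)\<close> this continuous_on_subset[OF cont subset_UNIV]]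
    obtain p where p: "p \<notin> C" "\<And>q. q \<notin> C \<Longrightarrow> \<theta> q \<le> \<theta> p" by blast
    obtain O' where O': "open O'" "connected O'" "p \<in> O'"
      "(\<forall>q\<in>O'. \<theta> q \<le> \<theta> p) \<longrightarrow> (\<exists>U. open U \<and> p \<in> U \<and> (\<forall>q\<in>U. \<theta> p = \<theta> q))"
      using smp[of p] by blast
    have "\<forall>q\<in>O'. \<theta> q \<le> \<theta> p"
    proof (rule ballI, rule ccontr)
      fix q assume "q \<in> O'" and q: "\<not> \<theta> q \<le> \<theta> p"
      define E where "E = {x. \<theta> x = \<theta> q}"
      have "open {x. \<theta> x \<noteq> \<theta> q}"
        using cont by (intro open_Collect_neq continuous_on_const)
      moreover have "open E"
      proof (rule Topological_Spaces.openI)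
        fix x assume "x \<in> E"
        then have "\<theta> x = \<theta> q" by (simp add: E_def)
        then have "x \<in> C" using p(2)[of x] q by linarith
        then obtain U where U: "open U" "x \<in> U" "\<forall>y\<in>U. \<theta> x = \<theta> y"
          unfolding C_def by blast
        have "\<theta> y = \<theta> q" if "y \<in> U" for y
          using U(3) that \<open>\<theta> x = \<theta> q\<close> by metis
        then have "U \<subseteq> E" unfolding E_def by blast
        with U(1,2) show "\<exists>T. open T \<and> x \<in> T \<and> T \<subseteq> E" by blast
      qed
      ultimately have "E \<inter> O' = {} \<or> {x. \<theta> x \<noteq> \<theta> q} \<inter> O' = {}"
        by (intro connectedD[OF O'(2)]) (auto simp: E_def)
      moreover have "q \<in> E \<inter> O'" using \<open>q \<in> O'\<close> by (simp add: E_def)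
      moreover have "p \<in> {x. \<theta> x \<noteq> \<theta> q} \<inter> O'" using q O'(3) by auto
      ultimately show False by blast
    qed
    then have "p \<in> C" unfolding C_def mem_Collect_eq by (rule mp[OF O'(4)])
    with p(1) show False by simp
  qed
  then have "p \<in> C" by blast
  then show ?thesis unfolding C_def by (rule CollectD)
qed

section \<open>From charts to the manifold\<close>

lemma smooth_on_subset: "smooth_on S h \<Longrightarrow> T \<subseteq> S \<Longrightarrow> smooth_on T h"
proof -
  have "Ck_on k S h \<Longrightarrow> T \<subseteq> S \<Longrightarrow> Ck_on k T h" for k
    by (induction k arbitrary: h) (auto intro: continuous_on_subset)
  then show "smooth_on S h \<Longrightarrow> T \<subseteq> S \<Longrightarrow> smooth_on T h" by (auto simp: smooth_on_def)
qed

lemma smooth_atlas_chart: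
  assumes "smooth_atlas A" "c \<in> A"
  shows "open (cdom c)" "open (cran c)" "homeomorphism (cdom c) (cran c) (cmap c) (cinv c)"
  using assms by (auto simp: smooth_atlas_def)

lemma homeomorphism_open_image:
  assumes "homeomorphism S T h k" "open T" "open U" "U \<subseteq> S"
  shows "open (h ` U)"
proof -
  have "openin (top_of_set S) U" using assms by (simp add: open_subset)
  then have "openin (top_of_set T) (h ` U)"
    using homeomorphism_imp_open_map[OF assms(1)] by blast
  then show ?thesis using assms(2) openin_open_trans by blast
qed

text \<open>Fixes the witnesses \<kappa> and \<theta> once for all charts, so that the local
  equations concern one global function.\<close>

locale lagrangian_soliton =
  fixes A :: "('m::{t2_space,second_countable_topology}, complex^'n) chart set"
    and g :: "('m, complex^'n) chart \<Rightarrow> (complex^'n) metric"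
    and f :: "'m \<Rightarrow> real"
    and B :: "('l::{t2_space,second_countable_topology}, real^'n) chart set"
    and F :: "'l \<Rightarrow> 'm"
    and \<kappa> :: real and \<theta> :: "'l \<Rightarrow> real"
  assumes soliton: "gradient_shrinking_kahler_ricci_soliton A g f"
    and atlas_B: "smooth_atlas B"
    and compact_L: "compact (UNIV :: 'l set)"
    and lagrangian: "lagrangian_immersion B A g F"
    and self_similar: "\<And>a c x. a \<in> B \<Longrightarrow> c \<in> A \<Longrightarrow> x \<in> repdom a c F \<Longrightarrow>
      mean_curvature (g c) (rep a c F) x =
        \<kappa> *\<^sub>R normal_part (g c) (rep a c F) x (gradient (g c) (f \<circ> cinv c) (rep a c F x))"
    and smooth_\<theta>: "smooth_function B \<theta>"
    and exact: "\<And>a c x v. a \<in> B \<Longrightarrow> c \<in> A \<Longrightarrow> x \<in> repdom a c F \<Longrightarrow>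
      mean_curvature_form (g c) (rep a c F) x v = D (\<theta> \<circ> cinv a) x v"
begin

lemma atlas_A: "smooth_atlas A"
  using soliton by (simp add: gradient_shrinking_kahler_ricci_soliton_def kahler_manifold_def
      holomorphic_atlas_def)

lemma cinv_cmap: "a \<in> B \<Longrightarrow> p \<in> cdom a \<Longrightarrow> cinv a (cmap a p) = p"
  using smooth_atlas_chart(3)[OF atlas_B] by (rule homeomorphism_apply1)

lemma open_domain: "c \<in> A \<Longrightarrow> open (F -` cdom c)"
  using lagrangian smooth_atlas_chart(1)[OF atlas_A]
  by (auto simp: lagrangian_immersion_def smooth_map_def continuous_on_eq_continuous_at
      intro: continuous_open_vimage)

lemma local_geometry:
  assumes a: "a \<in> B" and c: "c \<in> A"
  shows "local_self_similar (g c) (cran c) (rep a c F) (repdom a c F) (f \<circ> cinv c) \<kappa> (\<theta> \<circ> cinv a)"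
proof -
  have kahler: "kahler_manifold A g" and "smooth_function A f"
    and sol: "\<And>x v w. x \<in> cran c \<Longrightarrow>
      ricci (g c) x v w + hessian (g c) (f \<circ> cinv c) x v w - 1/2 * g c x v w = 0"
    using soliton c by (auto simp: gradient_shrinking_kahler_ricci_soliton_def)
  have metric: "riemannian_metric A g"
    using kahler by (simp add: kahler_manifold_def)
  have sub: "repdom a c F \<subseteq> cran a" by auto
  have imm: "smooth_on (repdom a c F) (rep a c F)"
      "\<And>x. x \<in> repdom a c F \<Longrightarrow> inj (D (rep a c F) x)"
      "\<And>x u v. x \<in> repdom a c F \<Longrightarrow>
        kahler_form (g c) (rep a c F x) (D (rep a c F) x u) (D (rep a c F) x v) = 0"
    using lagrangian a c unfolding lagrangian_immersion_def smooth_map_def by blast+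
  show ?thesis
  proof unfold_locales
    show "open (cran c)" by (rule smooth_atlas_chart(2)[OF atlas_A c])
    show "open (repdom a c F)"
      by (rule homeomorphism_open_image[OF smooth_atlas_chart(3,2)[OF atlas_B a]])
        (auto intro: open_domain[OF c] smooth_atlas_chart(1)[OF atlas_B a])
    show "rep a c F x \<in> cran c" if "x \<in> repdom a c F" for x
      using that cinv_cmap[OF a] by auto
    show "smooth_on (cran c) (f \<circ> cinv c)"
      using \<open>smooth_function A f\<close> c by (simp add: smooth_function_def)
    show "smooth_on (repdom a c F) (\<theta> \<circ> cinv a)"
      using smooth_\<theta> a sub by (auto simp: smooth_function_def intro: smooth_on_subset)
  qed (use metric kahler c sol imm self_similar[OF a c] exact[OF a c] in
      \<open>auto simp: riemannian_metric_def kahler_manifold_def\<close>)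
qed

lemma \<theta>_continuous: "continuous_on UNIV \<theta>"
proof -
  have "continuous_on (cdom a) \<theta>" if a: "a \<in> B" for a
  proof -
    have "continuous_on (cdom a) ((\<theta> \<circ> cinv a) \<circ> cmap a)"
      using smooth_\<theta> a homeomorphism_cont1[OF smooth_atlas_chart(3)[OF atlas_B a]]
      by (intro continuous_on_compose smooth_on_continuous_on) (auto simp: smooth_function_def)
    then show ?thesis
      by (rule continuous_on_eq) (simp add: cinv_cmap[OF a])
  qed
  then have "continuous_on (\<Union>a\<in>B. cdom a) \<theta>"
    using smooth_atlas_chart(1)[OF atlas_B] by (intro continuous_on_open_UN) auto
  then show ?thesis using atlas_B by (simp add: smooth_atlas_def)
qed

lemma obtain_charts:
  obtains a c where "a \<in> B" "c \<in> A" "p \<in> cdom a" "F p \<in> cdom c"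
proof -
  have "p \<in> (\<Union>a\<in>B. cdom a)" "F p \<in> (\<Union>c\<in>A. cdom c)"
    using atlas_A atlas_B by (simp_all add: smooth_atlas_def)
  then show thesis using that by blast
qed

lemma \<theta>_locally_constant: "\<exists>U. open U \<and> p \<in> U \<and> (\<forall>q\<in>U. \<theta> p = \<theta> q)"
proof (rule locally_constant_if_strong_maximum_principle[OF compact_L \<theta>_continuous])
  fix p
  obtain a c where ac: "a \<in> B" "c \<in> A" and p: "p \<in> cdom a" "F p \<in> cdom c"
    by (rule obtain_charts)
  interpret local_self_similar "g c" "cran c" "rep a c F" "repdom a c F" "f \<circ> cinv c" \<kappa> "\<theta> \<circ> cinv a"
    by (rule local_geometry[OF ac])
  let ?W = "repdom a c F" and ?x = "cmap a p" and ?h = "\<theta> \<circ> cinv a"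
  have hom: "homeomorphism (cran a) (cdom a) (cinv a) (cmap a)"
    using smooth_atlas_chart(3)[OF atlas_B ac(1)] by (rule homeomorphism_symD)
  have W: "?W \<subseteq> cran a" by auto
  have xW: "?x \<in> ?W" using p by auto
  have open_cinv: "open (cinv a ` U)" if "open U" "U \<subseteq> ?W" for U
    using homeomorphism_open_image[OF hom smooth_atlas_chart(1)[OF atlas_B ac(1)] that(1)] that(2) W by blast
  obtain r where r: "r > 0" "ball ?x r \<subseteq> ?W"
    using open_W xW open_contains_ball by metis
  obtain b where b: "continuous_on ?W b"
    "\<And>x. x \<in> ?W \<Longrightarrow> (\<Sum>i\<in>UNIV. \<Sum>j\<in>UNIV.
      inverse_gram x $ i $ j * D (\<lambda>y. D ?h y (axis j 1)) x (axis i 1)) = D ?h x (b x)"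
    by (rule \<theta>_elliptic_equation) blast
  show "\<exists>O'. open O' \<and> connected O' \<and> p \<in> O' \<and>
      ((\<forall>q\<in>O'. \<theta> q \<le> \<theta> p) \<longrightarrow> (\<exists>U. open U \<and> p \<in> U \<and> (\<forall>q\<in>U. \<theta> p = \<theta> q)))"
  proof (rule exI[of _ "cinv a ` ball ?x r"], intro conjI impI)
    show "open (cinv a ` ball ?x r)" by (rule open_cinv[OF open_ball r(2)])
    show "connected (cinv a ` ball ?x r)"
      by (intro connected_continuous_image connected_ball
          continuous_on_subset[OF homeomorphism_cont1[OF hom] subset_trans[OF r(2) W]])
    show "p \<in> cinv a ` ball ?x r"
      using r(1) cinv_cmap[OF ac(1) p(1)] by (metis centre_in_ball image_eqI)
    assume max: "\<forall>q\<in>cinv a ` ball ?x r. \<theta> q \<le> \<theta> p"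
    \<comment> \<open>The radius \<open>s\<close> given by the maximum principle need not be below
      \<open>r\<close>; the intersection keeps the neighbourhood inside the coordinate
      domain.\<close>
    have "\<exists>s>0. \<forall>x\<in>ball ?x r \<inter> ball ?x s. ?h x = ?h ?x"
    proof -
      have "\<exists>s>0. \<forall>x\<in>ball ?x s. ?h x = ?h ?x"
      proof (rule strong_maximum_principle_local[where U = "ball ?x r" and
            a = "\<lambda>x i j. inverse_gram x $ i $ j" and b = b])
        show "continuous_on (ball ?x r) (\<lambda>x. inverse_gram x $ i $ j)" for i j
          using continuous_on_W[OF inverse_gram_differentiable] r(2) continuous_on_subset by blast
        show "continuous_on (ball ?x r) b" using b(1) r(2) by (rule continuous_on_subset)
        show "smooth_on (ball ?x r) ?h" using smooth_\<theta> r(2)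
          by (rule smooth_on_subset)
        show "?h x \<le> ?h ?x" if "x \<in> ball ?x r" for x
          using max that cinv_cmap[OF ac(1) p(1)] by simp
        show "inverse_gram x $ i $ j = inverse_gram x $ j $ i" if "x \<in> ball ?x r" for x i j
          by (rule inverse_gram_sym[OF subsetD[OF r(2) that]])
        show "0 < (\<Sum>i\<in>UNIV. \<Sum>j\<in>UNIV. inverse_gram x $ i $ j * \<xi> $ i * \<xi> $ j)"
          if "x \<in> ball ?x r" "\<xi> \<noteq> 0" for x \<xi>
          by (rule inverse_gram_pos[OF subsetD[OF r(2) that(1)] that(2)])
        show "(\<Sum>i\<in>UNIV. \<Sum>j\<in>UNIV. inverse_gram x $ i $ j * D (\<lambda>y. D ?h y (axis j 1)) x (axis i 1)) =
            D ?h x (b x)" if "x \<in> ball ?x r" for x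
          by (rule b(2)[OF subsetD[OF r(2) that]])
      qed (use r(1) in auto)
      then show ?thesis by auto
    qed
    then obtain s where s: "s > 0" "\<And>x. x \<in> ball ?x r \<inter> ball ?x s \<Longrightarrow> ?h x = ?h ?x" by blast
    show "\<exists>U. open U \<and> p \<in> U \<and> (\<forall>q\<in>U. \<theta> p = \<theta> q)"
    proof (intro exI[of _ "cinv a ` (ball ?x r \<inter> ball ?x s)"] conjI ballI)
      show "open (cinv a ` (ball ?x r \<inter> ball ?x s))"
        using r(2) by (intro open_cinv) auto
      show "p \<in> cinv a ` (ball ?x r \<inter> ball ?x s)"
        using r(1) s(1) cinv_cmap[OF ac(1) p(1)] by (intro image_eqI[of _ _ ?x]) auto
      show "\<theta> p = \<theta> q" if "q \<in> cinv a ` (ball ?x r \<inter> ball ?x s)" for q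
        using that s(2) cinv_cmap[OF ac(1) p(1)] by auto
    qed
  qed
qed

text \<open>Local constancy of \<theta> already makes its differential, and with it the mean
  curvature form, vanish in every chart, however many components L has.\<close>

lemma minimal:
  assumes ac: "a \<in> B" "c \<in> A" and x: "x \<in> repdom a c F"
  shows "mean_curvature (g c) (rep a c F) x = 0"
proof -
  interpret local_self_similar "g c" "cran c" "rep a c F" "repdom a c F" "f \<circ> cinv c" \<kappa> "\<theta> \<circ> cinv a"
    by (rule local_geometry[OF ac])
  obtain p where p: "p \<in> cdom a" "x = cmap a p" using x by auto
  obtain U where U: "open U" "p \<in> U" "\<And>q. q \<in> U \<Longrightarrow> \<theta> p = \<theta> q"
    using \<theta>_locally_constant[of p] by blast
  have "open (cmap a ` (cdom a \<inter> U))"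
    using smooth_atlas_chart[OF atlas_B ac(1)] U(1) by (intro homeomorphism_open_image) auto
  then have "D (\<theta> \<circ> cinv a) x = D (\<lambda>_. \<theta> p) x"
  proof (rule D_cong)
    show "x \<in> cmap a ` (cdom a \<inter> U)" using p U(2) by auto
    show "(\<theta> \<circ> cinv a) y = \<theta> p" if "y \<in> cmap a ` (cdom a \<inter> U)" for y
      using that U(3) cinv_cmap[OF ac(1)] by force
  qed
  then show ?thesis
    by (intro mean_curvature_eq_0[OF x]) (simp add: exact[OF x])
qed

end

theorem theorem1p12:
  fixes A :: "('m::{t2_space,second_countable_topology}, complex^'n) chart set"
    and g :: "('m, complex^'n) chart \<Rightarrow> (complex^'n) metric"
    and f :: "'m \<Rightarrow> real"
    and B :: "('l::{t2_space,second_countable_topology}, real^'n) chart set"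
    and F :: "'l \<Rightarrow> 'm"
  assumes "gradient_shrinking_kahler_ricci_soliton A g f"
    and "smooth_atlas B"
    and "compact (UNIV :: 'l set)"
    and "lagrangian_immersion B A g F"
    and "self_similar_solution B A g f F"
    and "exact_mean_curvature_form B A g F"
  shows "minimal_lagrangian_immersion B A g F"
proof -
  obtain \<kappa> where \<kappa>: "\<And>a c x. a \<in> B \<Longrightarrow> c \<in> A \<Longrightarrow> x \<in> repdom a c F \<Longrightarrow>
      mean_curvature (g c) (rep a c F) x =
        \<kappa> *\<^sub>R normal_part (g c) (rep a c F) x (gradient (g c) (f \<circ> cinv c) (rep a c F x))"
    using assms(5) unfolding self_similar_solution_def by blast
  obtain \<theta> where \<theta>: "smooth_function B \<theta>" "\<And>a c x v. a \<in> B \<Longrightarrow> c \<in> A \<Longrightarrow> x \<in> repdom a c F \<Longrightarrow>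
      mean_curvature_form (g c) (rep a c F) x v = D (\<theta> \<circ> cinv a) x v"
    using assms(6) unfolding exact_mean_curvature_form_def by blast
  interpret lagrangian_soliton A g f B F \<kappa> \<theta>
    by unfold_locales (fact assms \<kappa> \<theta>)+
  show ?thesis
    using assms(4) minimal by (simp add: minimal_lagrangian_immersion_def)
qed

end
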